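(* Let $A\in\mathbb{C}^{n\times n}$ be a 1-almost normal matrix with $C=\mathbf{u}\mathbf{v}^H$, i.e. $\mathbf{u},\mathbf{v}\in\mathbb{C}^n$ are nonzero and $A^HA-AA^H=CA-AC$ with $C=\mathbf{u}\mathbf{v}^H$. If $\mathbf{u}$ and $\mathbf{v}$ are linearly independent, then $$\mathcal{K}_j(A_{AH},\langle\mathbf{u},\mathbf{v}\rangle)\subseteq \mathcal{K}_j(A_H,\langle\mathbf{u},\mathbf{v}\rangle)\quad\text{for each } j.$$ Thus, if the block Lanczos process applied to $A_H$ with an initial matrix whose columns span $\mathrm{span}\{\mathbf{u},\mathbf{v}\}$ does not break down prematurely, and $U$ denotes the unitary matrix it produces, then $U^HA_HU$ and $U^HA_{AH}U$ are block tridiagonal and, hence, $U^HAU$ is block tridiagonal as well (all with respect to the block partition produced by the process). The size of the blocks is at most two.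
   Context: $A^H$ is the conjugate transpose of $A$. A matrix $A\in\mathbb{C}^{n\times n}$ is $k$-almost normal if there is a rank-$k$ matrix $C$ with $A^HA-AA^H=CA-AC$. The Hermitian and antihermitian parts of $A$ are $A_H=\frac{A+A^H}{2}$ and $A_{AH}=\frac{A-A^H}{2}$. Block Krylov subspaces: for $H\in\mathbb{C}^{n\times n}$ and $Z\in\mathbb{C}^{n\times\ell}$, $\mathcal{K}_j(H,Z)$ is the span of the columns of $Z,HZ,\dots,H^{j-1}Z$. $\mathcal{K}_j(H,\langle \mathbf{z}_1,\dots,\mathbf{z}_\ell\rangle)$ denotes $\mathcal{K}_j(H,X)$ for any $X\in\mathbb{C}^{n\times\ell}$ whose columns span $\mathrm{span}\{\mathbf{z}_1,\dots,\mathbf{z}_\ell\}$. Block Lanczos process: given a Hermitian $H\in\mathbb{C}^{n\times n}$ and a nonzero $Z\in\mathbb{C}^{n\times \ell}$, $\ell\le n$, let the columns of $U_1$ be an orthonormal basis of the column space of $Z$. For $k\ge1$, while the total number of columns of $U_1,\dots,U_k$ is less than $n$, form $W=HU_k-U_kU_k^HHU_k-U_{k-1}U_{k-1}^HHU_k$ (the last term is absent for $k=1$). If $W=0$ the process breaks down (premature stop); otherwise the columns of $U_{k+1}$ are an orthonormal basis of the column space of $W$ (left singular vectors of $W$ for its nonzero singular values). If there is no premature stop, the output is the unitary matrix $U=[U_1|\cdots|U_p]\in\mathbb{C}^{n\times n}$, with $U_k\in\mathbb{C}^{n\times i_k}$, $\ell\ge i_1\ge i_2\ge\dots\ge i_p$,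 $i_1+\dots+i_p=n$. "Block tridiagonal" means block tridiagonal with respect to the partition $(i_1,\dots,i_p)$; the block sizes are the $i_k$. *)

theory Defs
  imports "Jordan_Normal_Form.Schur_Decomposition" "Jordan_Normal_Form.DL_Rank"
begin

abbreviation cspan :: "nat \<Rightarrow> complex vec set \<Rightarrow> complex vec set" where
  "cspan n S \<equiv> LinearCombinations.module.span class_ring (module_vec TYPE(complex) n) S"

abbreviation column_space :: "nat \<Rightarrow> complex mat \<Rightarrow> complex vec set" where
  "column_space n M \<equiv> vec_space.col_space n M"

text \<open>The library predicate \<open>lin_dep\<close> is about sets, so that for \<open>u = v\<close> it would only see the
  singleton \<open>{u}\<close>; the family \<open>(u, v)\<close> is then dependent, whence \<open>u \<noteq> v\<close>.\<close>

definition lin_indpt_pair :: "nat \<Rightarrow> complex vec \<Rightarrow> complex vec \<Rightarrow> bool" where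
  "lin_indpt_pair n u v \<longleftrightarrow>
     u \<noteq> v \<and> \<not> module.lin_dep class_ring (module_vec TYPE(complex) n) {u, v}"

definition outer_product :: "nat \<Rightarrow> complex vec \<Rightarrow> complex vec \<Rightarrow> complex mat" where
  "outer_product n u v = mat_of_cols n [u] * mat_adjoint (mat_of_cols n [v])"

definition hermitian :: "complex mat \<Rightarrow> bool" where
  "hermitian M \<longleftrightarrow> mat_adjoint M = M"

definition unitary :: "nat \<Rightarrow> complex mat \<Rightarrow> bool" where
  "unitary n U \<longleftrightarrow>
     U \<in> carrier_mat n n \<and> mat_adjoint U * U = 1\<^sub>m n \<and> U * mat_adjoint U = 1\<^sub>m n"

definition hermitian_part :: "complex mat \<Rightarrow> complex mat" where
  "hermitian_part A = (1 / 2) \<cdot>\<^sub>m (A + mat_adjoint A)"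

definition antihermitian_part :: "complex mat \<Rightarrow> complex mat" where
  "antihermitian_part A = (1 / 2) \<cdot>\<^sub>m (A - mat_adjoint A)"

text \<open>\<open>A\<close> is \<open>k\<close>-almost normal iff \<open>almost_normal_via n k A C\<close> for some \<open>C\<close>.\<close>

definition almost_normal_via :: "nat \<Rightarrow> nat \<Rightarrow> complex mat \<Rightarrow> complex mat \<Rightarrow> bool" where
  "almost_normal_via n k A C \<longleftrightarrow>
     A \<in> carrier_mat n n \<and> C \<in> carrier_mat n n \<and> vec_space.rank n C = k \<and>
     mat_adjoint A * A - A * mat_adjoint A = C * A - A * C"

definition krylov :: "nat \<Rightarrow> nat \<Rightarrow> complex mat \<Rightarrow> complex mat \<Rightarrow> complex vec set" where
  "krylov n j H Z = cspan n (\<Union>i<j. set (cols (H ^\<^sub>m i * Z)))"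

definition columns_orthonormal_basis :: "nat \<Rightarrow> complex mat \<Rightarrow> complex vec set \<Rightarrow> bool" where
  "columns_orthonormal_basis n Q S \<longleftrightarrow>
     Q \<in> carrier_mat n (dim_col Q) \<and> mat_adjoint Q * Q = 1\<^sub>m (dim_col Q) \<and> column_space n Q = S"

text \<open>A list \<open>[U\<^sub>1, \<dots>, U\<^sub>k]\<close> is the sequence of blocks computed so far.\<close>

definition block_sizes :: "complex mat list \<Rightarrow> nat list" where
  "block_sizes Us = map dim_col Us"

definition concat_blocks :: "nat \<Rightarrow> complex mat list \<Rightarrow> complex mat" where
  "concat_blocks n Us = mat_of_cols n (concat (map cols Us))"

definition lanczos_residual :: "complex mat \<Rightarrow> complex mat list \<Rightarrow> complex mat" where
  "lanczos_residual H Us =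
     (let V = last Us; R = H * V - V * mat_adjoint V * H * V in
      if length Us = 1 then R
      else (let P = last (butlast Us) in R - P * mat_adjoint P * H * V))"

text \<open>The orthonormal bases are not determined by the subspaces they span, so the process is a
  relation: every admissible choice of bases yields a run.\<close>

inductive lanczos_run :: "nat \<Rightarrow> complex mat \<Rightarrow> complex mat \<Rightarrow> complex mat list \<Rightarrow> bool"
  for n H Z where
  start: "columns_orthonormal_basis n U (column_space n Z) \<Longrightarrow> lanczos_run n H Z [U]"
| step: "\<lbrakk>lanczos_run n H Z Us; sum_list (block_sizes Us) < n;
          W = lanczos_residual H Us; W \<noteq> 0\<^sub>m n (dim_col W);
          columns_orthonormal_basis n U (column_space n W)\<rbrakk>
         \<Longrightarrow> lanczos_run n H Z (Us @ [U])"

text \<open>A run that has broken down (\<open>W = 0\<close>) is stuck with fewer than \<open>n\<close> columns; the last conjunct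
  says that the process has terminated without a premature stop.\<close>

definition block_lanczos_output ::
  "nat \<Rightarrow> complex mat \<Rightarrow> complex mat \<Rightarrow> complex mat list \<Rightarrow> bool" where
  "block_lanczos_output n H Z Us \<longleftrightarrow>
     H \<in> carrier_mat n n \<and> hermitian H \<and>
     Z \<in> carrier_mat n (dim_col Z) \<and> Z \<noteq> 0\<^sub>m n (dim_col Z) \<and> dim_col Z \<le> n \<and>
     lanczos_run n H Z Us \<and> \<not> sum_list (block_sizes Us) < n"

text \<open>In the partition \<open>ms\<close>, entry \<open>(r, c)\<close> of block \<open>(i, j)\<close> sits at offset
  \<open>(ms\<^sub>0 + \<dots> + ms\<^sub>i\<^sub>-\<^sub>1, ms\<^sub>0 + \<dots> + ms\<^sub>j\<^sub>-\<^sub>1)\<close>.\<close>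

definition block_tridiagonal :: "nat list \<Rightarrow> complex mat \<Rightarrow> bool" where
  "block_tridiagonal ms T \<longleftrightarrow>
     T \<in> carrier_mat (sum_list ms) (sum_list ms) \<and>
     (\<forall>i < length ms. \<forall>j < length ms. Suc i < j \<or> Suc j < i \<longrightarrow>
        (\<forall>r < ms ! i. \<forall>c < ms ! j.
           T $$ (sum_list (take i ms) + r, sum_list (take j ms) + c) = 0))"

end

theory Submission
  imports Defs
begin

text \<open>Let \<open>H\<close> and \<open>K\<close> be the hermitian and antihermitian parts of \<open>A\<close>, so that \<open>A = H + K\<close> and
  \<open>A\<^sup>H = H - K\<close>.  Then \<open>A\<^sup>H A - A A\<^sup>H = 2 (H K - K H)\<close>, and the hypothesis says that this
  matrix equals \<open>C A - A C\<close> with \<open>C = u v\<^sup>H\<close>.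

  The left-hand side is self-adjoint.  Written out, self-adjointness of \<open>C A - A C\<close> is a linear relation
  between the vectors \<open>u\<close>, \<open>v\<close>, \<open>A u\<close> and \<open>A\<^sup>H v\<close>; testing it against the basis dual to the
  independent vectors \<open>u\<close>, \<open>v\<close> shows that \<open>A u\<close> and \<open>A\<^sup>H v\<close> lie in \<open>S = span {u, v}\<close>
  (\<open>almost_normal_images\<close>).  Two consequences follow: \<open>K\<close> maps \<open>S\<close> into \<open>S + H S\<close>
  (\<open>almost_normal_antihermitian_image\<close>), and \<open>H K - K H\<close> maps everything into \<open>S\<close>
  (\<open>almost_normal_commutator\<close>).

  These two facts suffice.  Take any chain of subspaces that starts at \<open>S\<close> and in which every member is
  obtained from its predecessor by adjoining images under \<open>H\<close>.  Commuting \<open>K\<close> past \<open>H\<close> costs only an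
  element of \<open>S\<close>, so by induction \<open>K\<close> raises the level in the chain by at most one, as \<open>H\<close> does
  (\<open>commuting_modulo_start_respects_filtration\<close>).  For the chain of Krylov subspaces of \<open>H\<close> this gives the
  inclusion of Krylov subspaces (\<open>krylov_subset_krylov\<close>).

  The spans of the first blocks of a Lanczos run on \<open>H\<close> form another such chain, and the blocks are
  mutually orthogonal because \<open>H\<close> is hermitian (\<open>lanczos_blocks_step\<close>).  Hence \<open>H\<close>, \<open>K\<close> and
  \<open>A\<close>, as well as their adjoints \<open>H\<close>, \<open>-K\<close> and \<open>H - K\<close>, move a block at most one block further, and
  orthogonality turns this into block tridiagonality (\<open>block_tridiagonal_compression\<close>).  A run that
  stops with at least \<open>n\<close> orthonormal columns in dimension \<open>n\<close> has exactly \<open>n\<close> of them, so the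
  assembled matrix is unitary.  The first block has at most two columns because it spans \<open>S\<close>, and each later
  block is an orthonormal basis of the column space of a matrix with as many columns as the preceding block.\<close>

section \<open>Complex spans and linear maps\<close>

context
  fixes n :: nat
begin

interpretation vs: vec_space "TYPE(complex)" n .

lemma cspan_carrier: "S \<subseteq> carrier_vec n \<Longrightarrow> cspan n S \<subseteq> carrier_vec n"
  by (rule vs.span_is_subset2)

lemma cspan_zero: "0\<^sub>v n \<in> cspan n S"
  by (rule vs.in_spanI[of _ "\<lambda>_. 0" "{}"]) (auto simp: vs.lincomb_def)

lemma cspan_superset: "S \<subseteq> carrier_vec n \<Longrightarrow> S \<subseteq> cspan n S"
  by (rule vs.in_own_span)

lemma cspan_add:
  "S \<subseteq> carrier_vec n \<Longrightarrow> x \<in> cspan n S \<Longrightarrow> y \<in> cspan n S \<Longrightarrow> x + y \<in> cspan n S"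
  using vs.span_add1[of S x y] by simp

lemma cspan_smult: "S \<subseteq> carrier_vec n \<Longrightarrow> x \<in> cspan n S \<Longrightarrow> c \<cdot>\<^sub>v x \<in> cspan n S"
  by (rule vs.smult_in_span)

lemma cspan_diff:
  assumes S: "S \<subseteq> carrier_vec n" and x: "x \<in> cspan n S" and y: "y \<in> cspan n S"
  shows "x - y \<in> cspan n S"
proof -
  have "x \<in> carrier_vec n" "y \<in> carrier_vec n"
    using cspan_carrier[OF S] x y by auto
  then have "x - y = x + (-1) \<cdot>\<^sub>v y"
    by (intro eq_vecI) auto
  then show ?thesis
    using cspan_add[OF S x cspan_smult[OF S y]] by simp
qed

lemma cspan_minimal:
  "T \<subseteq> carrier_vec n \<Longrightarrow> S \<subseteq> cspan n T \<Longrightarrow> cspan n S \<subseteq> cspan n T"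
  by (rule vs.span_subsetI)

lemma cspan_mono: "S \<subseteq> T \<Longrightarrow> cspan n S \<subseteq> cspan n T"
  by (rule vs.span_is_monotone)

lemma cspan_induct [consumes 2, case_names zero base add smult]:
  assumes x: "x \<in> cspan n S" and S: "S \<subseteq> carrier_vec n"
    and zero: "P (0\<^sub>v n)" and base: "\<And>x. x \<in> S \<Longrightarrow> P x"
    and add: "\<And>x y. x \<in> carrier_vec n \<Longrightarrow> y \<in> carrier_vec n \<Longrightarrow> P x \<Longrightarrow> P y \<Longrightarrow> P (x + y)"
    and smult: "\<And>c x. x \<in> carrier_vec n \<Longrightarrow> P x \<Longrightarrow> P (c \<cdot>\<^sub>v x)"
  shows "P x"
proof -
  obtain a F where xF: "x = vs.lincomb a F" and F: "finite F" "F \<subseteq> S"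
    using vs.in_spanE[OF x] by blast
  have "P (vs.lincomb a F) \<and> vs.lincomb a F \<in> carrier_vec n"
    using F
  proof (induction F rule: finite_induct)
    case empty
    then show ?case using zero by (simp add: vs.lincomb_def)
  next
    case (insert y F)
    have y: "y \<in> S" "y \<in> carrier_vec n" and F: "F \<subseteq> carrier_vec n"
      using insert.prems S by auto
    have eq: "vs.lincomb a (insert y F) = a y \<cdot>\<^sub>v y + vs.lincomb a F"
      using vs.lincomb_insert2[of F a y] insert.hyps y F by simp
    show ?case
      unfolding eq using insert.IH insert.prems y base smult add by simp
  qed
  then show ?thesis using xF by simp
qed

lemma mult_mat_vec_cspan:
  assumes M: "M \<in> carrier_mat n n" and S: "S \<subseteq> carrier_vec n" and T: "T \<subseteq> carrier_vec n"
    and img: "\<And>x. x \<in> S \<Longrightarrow> M *\<^sub>v x \<in> cspan n T" and x: "x \<in> cspan n S"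
  shows "M *\<^sub>v x \<in> cspan n T"
  using x S
proof (induction rule: cspan_induct)
  case zero
  have "M *\<^sub>v 0\<^sub>v n = 0\<^sub>v n" using M by auto
  then show ?case using cspan_zero by simp
next
  case (base x) then show ?case by (rule img)
next
  case (add x y)
  then show ?case
    unfolding mult_add_distrib_mat_vec[OF M add(1,2)] by (intro cspan_add[OF T])
next
  case (smult c x)
  then show ?case
    unfolding mult_mat_vec[OF M smult(1)] by (intro cspan_smult[OF T])
qed

lemma cspan_orthogonal:
  assumes S: "S \<subseteq> carrier_vec n" and y: "y \<in> carrier_vec n"
    and orth: "\<And>x. x \<in> S \<Longrightarrow> x \<bullet>c y = 0" and x: "x \<in> cspan n S"
  shows "x \<bullet>c y = 0"
  using x S
proof (induction rule: cspan_induct)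
  case zero then show ?case using y by simp
next
  case (base x) then show ?case by (rule orth)
next
  case (add a b) then show ?case
    using add_scalar_prod_distrib[of a n b "conjugate y"] y by simp
next
  case (smult c a) then show ?case
    using smult_scalar_prod_distrib[of a n "conjugate y" c] y by simp
qed

lemma lincomb_pair_in_cspan:
  assumes "u \<in> carrier_vec n" "v \<in> carrier_vec n"
  shows "a \<cdot>\<^sub>v u + b \<cdot>\<^sub>v v \<in> cspan n {u, v}"
  using assms cspan_superset[of "{u, v}"] by (intro cspan_add cspan_smult) auto

lemma column_space_iff:
  assumes "M \<in> carrier_mat n m"
  shows "y \<in> column_space n M \<longleftrightarrow> (\<exists>x \<in> carrier_vec m. M *\<^sub>v x = y)"
  using assms vs.col_space_eq[OF assms] by auto

lemma column_space_eq_cspan_cols: "column_space n M = cspan n (set (cols M))"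
  by (rule vs.col_space_def)

text \<open>Bridges linear independence of a set of vectors and the form in which it is used below: an
  orthogonal projection of one of the two vectors onto the other leaves a nonzero rest.\<close>

lemma lin_indpt_pair_not_multiple:
  assumes ind: "lin_indpt_pair n u v" and u: "u \<in> carrier_vec n" and v: "v \<in> carrier_vec n"
  shows "u \<noteq> c \<cdot>\<^sub>v v"
proof
  assume eq: "u = c \<cdot>\<^sub>v v"
  have ne: "u \<noteq> v" and indpt: "\<not> vs.lin_dep {u, v}"
    using ind by (auto simp: lin_indpt_pair_def)
  have "u \<in> cspan n {v}"
    unfolding eq using v cspan_superset[of "{v}"] by (intro cspan_smult) auto
  moreover have "{u, v} - {u} = {v}" using ne by auto
  ultimately have "vs.lin_dep {u, v}"
    using vs.lindep_span[of "{u, v}"] u v by auto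
  with indpt show False by simp
qed

end

section \<open>Adjoints and inner products\<close>

lemma dim_mat_adjoint [simp]:
  "dim_row (mat_adjoint A) = dim_col A" "dim_col (mat_adjoint A) = dim_row A"
  by (auto simp: mat_adjoint_def)

lemma mat_adjoint_carrier [simp]:
  "A \<in> carrier_mat m k \<Longrightarrow> mat_adjoint A \<in> carrier_mat k m"
  by auto

lemma row_mat_adjoint [simp]:
  "i < dim_col A \<Longrightarrow> row (mat_adjoint A) i = conjugate (col A i)"
  by (auto simp: mat_adjoint_def)

lemma index_mat_adjoint [simp]:
  "i < dim_col A \<Longrightarrow> j < dim_row A \<Longrightarrow> mat_adjoint A $$ (i, j) = conjugate (A $$ (j, i))"
  by (auto simp: mat_adjoint_def mat_of_rows_index)

lemma mat_adjoint_adjoint [simp]: "mat_adjoint (mat_adjoint A) = (A :: complex mat)"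
  by (intro eq_matI) auto

lemma cscalar_prod_conjugate_commute:
  fixes x y :: "complex vec"
  assumes "x \<in> carrier_vec n" "y \<in> carrier_vec n"
  shows "cnj (x \<bullet>c y) = y \<bullet>c x"
  using conjugate_sprod_vec[of x n "conjugate y"] comm_scalar_prod[of y n "conjugate x"] assms
  by simp

lemma cscalar_prod_adjoint:
  fixes M :: "complex mat"
  assumes M: "M \<in> carrier_mat m k" and x: "x \<in> carrier_vec k" and y: "y \<in> carrier_vec m"
  shows "(M *\<^sub>v x) \<bullet>c y = x \<bullet>c (mat_adjoint M *\<^sub>v y)"
proof -
  have "(M *\<^sub>v x) \<bullet>c y = (\<Sum>i<m. \<Sum>j<k. M $$ (i, j) * x $ j * cnj (y $ i))"
    using assms by (simp add: scalar_prod_def sum_distrib_right lessThan_atLeast0)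
  also have "\<dots> = (\<Sum>j<k. \<Sum>i<m. M $$ (i, j) * x $ j * cnj (y $ i))"
    by (rule sum.swap)
  also have "\<dots> = x \<bullet>c (mat_adjoint M *\<^sub>v y)"
    using assms by (simp add: scalar_prod_def sum_distrib_left lessThan_atLeast0 algebra_simps)
  finally show ?thesis .
qed

lemma cscalar_prod_nondegenerate:
  fixes x y :: "complex vec"
  assumes x: "x \<in> carrier_vec n" and y: "y \<in> carrier_vec n"
    and eq: "\<And>z. z \<in> carrier_vec n \<Longrightarrow> x \<bullet>c z = y \<bullet>c z"
  shows "x = y"
proof -
  have "(x - y) \<bullet>c (x - y) = 0"
    using eq[of "x - y"] x y by (simp add: minus_scalar_prod_distrib[of _ n])
  then have "x - y = 0\<^sub>v n" using conjugate_square_eq_0_vec[of "x - y" n] x y by simp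
  then show ?thesis
    using x y by (metis eq_vecI carrier_vecD index_minus_vec(1) index_zero_vec(1) eq_iff_diff_eq_0)
qed

lemma outer_product_mult_vec:
  assumes "u \<in> carrier_vec n" "v \<in> carrier_vec n" "x \<in> carrier_vec n"
  shows "outer_product n u v *\<^sub>v x = (x \<bullet>c v) \<cdot>\<^sub>v u"
proof -
  have "mat_adjoint (mat_of_cols n [v]) *\<^sub>v x = vec 1 (\<lambda>_. x \<bullet>c v)"
    using assms by (intro eq_vecI) (auto simp: conjugate_vec_sprod_comm)
  moreover have "mat_of_cols n [u] *\<^sub>v vec 1 (\<lambda>_. x \<bullet>c v) = (x \<bullet>c v) \<cdot>\<^sub>v u"
    using assms
    by (intro eq_vecI) (auto simp: scalar_prod_def mat_of_cols_index row_def)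
  ultimately show ?thesis
    unfolding outer_product_def using assms
    by (subst assoc_mult_mat_vec[of _ n 1 _ n]) (auto simp: mat_of_cols_carrier)
qed

lemma outer_product_carrier: "outer_product n u v \<in> carrier_mat n n"
  unfolding outer_product_def by (rule mult_carrier_mat[of _ n 1]) auto

section \<open>Hermitian and antihermitian parts\<close>

lemma hermitian_part_carrier:
  "A \<in> carrier_mat n n \<Longrightarrow> hermitian_part A \<in> carrier_mat n n"
  by (auto simp: hermitian_part_def)

lemma antihermitian_part_carrier:
  "A \<in> carrier_mat n n \<Longrightarrow> antihermitian_part A \<in> carrier_mat n n"
  by (auto simp: antihermitian_part_def)

lemma hermitian_part_plus_antihermitian_part:
  assumes "A \<in> carrier_mat n n"
  shows "hermitian_part A + antihermitian_part A = A"
  using assms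
  by (intro eq_matI) (auto simp: hermitian_part_def antihermitian_part_def field_simps)

lemma mat_adjoint_eq_hermitian_part_minus_antihermitian_part:
  assumes "A \<in> carrier_mat n n"
  shows "hermitian_part A - antihermitian_part A = mat_adjoint A"
  using assms
  by (intro eq_matI) (auto simp: hermitian_part_def antihermitian_part_def field_simps)

lemma mat_adjoint_antihermitian_part:
  assumes "A \<in> carrier_mat n n"
  shows "mat_adjoint (antihermitian_part A) = - antihermitian_part A"
  using assms by (intro eq_matI) (auto simp: antihermitian_part_def field_simps)

lemma self_commutator_mult_vec:
  fixes A :: "complex mat"
  assumes A: "A \<in> carrier_mat n n" and x: "x \<in> carrier_vec n"
  shows "(mat_adjoint A * A - A * mat_adjoint A) *\<^sub>v x
    = mat_adjoint A *\<^sub>v (A *\<^sub>v x) - A *\<^sub>v (mat_adjoint A *\<^sub>v x)"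
proof -
  note B = mat_adjoint_carrier[OF A]
  show ?thesis
    using minus_mult_distrib_mat_vec[OF mult_carrier_mat[OF B A] mult_carrier_mat[OF A B] x]
    by (simp only: assoc_mult_mat_vec[OF A B x] assoc_mult_mat_vec[OF B A x])
qed

text \<open>With \<open>A = H + K\<close> and \<open>A\<^sup>H = H - K\<close>, the products \<open>H H\<close> and \<open>K K\<close> cancel in
  \<open>A\<^sup>H A - A A\<^sup>H\<close> and the mixed ones add up to \<open>2 (H K - K H)\<close>.  The almost normality
  equation is therefore a statement about how far the two parts are from commuting.\<close>

lemma commutator_of_parts_eq_half_self_commutator:
  assumes A: "A \<in> carrier_mat n n" and x: "x \<in> carrier_vec n"
  defines "H \<equiv> hermitian_part A" and "K \<equiv> antihermitian_part A"
  shows "H *\<^sub>v (K *\<^sub>v x) - K *\<^sub>v (H *\<^sub>v x) =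
    (1/2) \<cdot>\<^sub>v ((mat_adjoint A * A - A * mat_adjoint A) *\<^sub>v x)"
proof -
  have H: "H \<in> carrier_mat n n" and K: "K \<in> carrier_mat n n"
    unfolding H_def K_def using A by (auto intro: hermitian_part_carrier antihermitian_part_carrier)
  have Aeq: "A = H + K" and Adj: "mat_adjoint A = H - K"
    unfolding H_def K_def
    using hermitian_part_plus_antihermitian_part[OF A]
      mat_adjoint_eq_hermitian_part_minus_antihermitian_part[OF A] by auto
  have AAd: "A *\<^sub>v y = H *\<^sub>v y + K *\<^sub>v y" "mat_adjoint A *\<^sub>v y = H *\<^sub>v y - K *\<^sub>v y"
    if "y \<in> carrier_vec n" for y
    unfolding Adj by (subst Aeq, rule add_mult_distrib_mat_vec[OF H K that],
      rule minus_mult_distrib_mat_vec[OF H K that])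
  define a b c d where "a = H *\<^sub>v (H *\<^sub>v x)" and "b = H *\<^sub>v (K *\<^sub>v x)"
    and "c = K *\<^sub>v (H *\<^sub>v x)" and "d = K *\<^sub>v (K *\<^sub>v x)"
  have car: "a \<in> carrier_vec n" "b \<in> carrier_vec n" "c \<in> carrier_vec n" "d \<in> carrier_vec n"
    using H K x by (auto simp: a_def b_def c_def d_def)
  have Hx: "H *\<^sub>v x \<in> carrier_vec n" and Kx: "K *\<^sub>v x \<in> carrier_vec n" using H K x by auto
  have "(mat_adjoint A * A - A * mat_adjoint A) *\<^sub>v x =
    mat_adjoint A *\<^sub>v (A *\<^sub>v x) - A *\<^sub>v (mat_adjoint A *\<^sub>v x)"
    by (rule self_commutator_mult_vec[OF A x])
  also have "\<dots> = ((a + b) - (c + d)) - ((a - b) + (c - d))"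
    using Hx Kx x H K
    by (simp add: AAd a_def b_def c_def d_def mult_add_distrib_mat_vec[OF H]
        mult_add_distrib_mat_vec[OF K] mult_minus_distrib_mat_vec[OF H]
        mult_minus_distrib_mat_vec[OF K])
  also have "\<dots> = 2 \<cdot>\<^sub>v (b - c)"
    using car by (intro eq_vecI) auto
  finally show ?thesis
    using car unfolding b_def[symmetric] c_def[symmetric] by (simp add: smult_smult_assoc)
qed

section \<open>Consequences of the almost normality equation\<close>

text \<open>\<open>w\<close> is the component of \<open>u\<close> orthogonal to \<open>v\<close>, scaled; independence is what makes that
  component nonzero.\<close>

lemma dual_vector:
  assumes u: "u \<in> carrier_vec n" and v: "v \<in> carrier_vec n"
    and ind: "\<And>c. u \<noteq> c \<cdot>\<^sub>v v" and v0: "v \<noteq> 0\<^sub>v n"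
  obtains w where "w \<in> carrier_vec n" "w \<bullet>c u = 1" "w \<bullet>c v = (0 :: complex)"
proof -
  \<comment> \<open>The Gram-Schmidt coefficient: \<open>r\<close> is orthogonal to \<open>v\<close>.\<close>
  define c where "c = (u \<bullet>c v) / (v \<bullet>c v)"
  define r where "r = u - c \<cdot>\<^sub>v v"
  have r: "r \<in> carrier_vec n" using u v by (simp add: r_def)
  have vv: "v \<bullet>c v \<noteq> 0" using v v0 by simp
  have rv: "r \<bullet>c v = 0"
    using u v vv by (simp add: r_def c_def minus_scalar_prod_distrib[of _ n])
  have r0: "r \<noteq> 0\<^sub>v n"
  proof
    assume "r = 0\<^sub>v n"
    then have "u $ i = (c \<cdot>\<^sub>v v) $ i" if "i < n" for i
      using that u v unfolding r_def by (metis index_minus_vec(1) index_zero_vec(1) carrier_vecD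
          eq_iff_diff_eq_0 index_smult_vec(2))
    then have "u = c \<cdot>\<^sub>v v" using u v by (intro eq_vecI) auto
    with ind show False by blast
  qed
  have "u = r + c \<cdot>\<^sub>v v" using u v by (intro eq_vecI) (auto simp: r_def)
  then have "r \<bullet>c u = r \<bullet>c (r + c \<cdot>\<^sub>v v)" by simp
  also have "\<dots> = r \<bullet>c r"
    using r v rv
    by (simp add: conjugate_add_vec[of _ n] conjugate_smult_vec scalar_prod_add_distrib[of _ n])
  finally have "r \<bullet>c u \<noteq> 0" using r r0 by simp
  then show thesis
    using that[of "(1 / (r \<bullet>c u)) \<cdot>\<^sub>v r"] r u v rv by simp
qed

lemma almost_normal_mult_vec:
  assumes A: "A \<in> carrier_mat n n" and u: "u \<in> carrier_vec n" and v: "v \<in> carrier_vec n"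
    and D: "mat_adjoint A * A - A * mat_adjoint A
      = outer_product n u v * A - A * outer_product n u v"
    and x: "x \<in> carrier_vec n"
  shows "(mat_adjoint A * A - A * mat_adjoint A) *\<^sub>v x
    = ((A *\<^sub>v x) \<bullet>c v) \<cdot>\<^sub>v u - (x \<bullet>c v) \<cdot>\<^sub>v (A *\<^sub>v u)"
proof -
  note C = outer_product_carrier[of n u v]
  have Ax: "A *\<^sub>v x \<in> carrier_vec n" using A x by auto
  have "(outer_product n u v * A - A * outer_product n u v) *\<^sub>v x =
    outer_product n u v *\<^sub>v (A *\<^sub>v x) - A *\<^sub>v (outer_product n u v *\<^sub>v x)"
    using A C x by (subst minus_mult_distrib_mat_vec[of _ n n]) auto
  then show ?thesis
    unfolding D outer_product_mult_vec[OF u v x] outer_product_mult_vec[OF u v Ax]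
    using mult_mat_vec[OF A u] by simp
qed

lemma self_commutator_self_adjoint:
  fixes A :: "complex mat"
  assumes A: "A \<in> carrier_mat n n" and x: "x \<in> carrier_vec n" and y: "y \<in> carrier_vec n"
  defines "D \<equiv> mat_adjoint A * A - A * mat_adjoint A"
  shows "(D *\<^sub>v x) \<bullet>c y = x \<bullet>c (D *\<^sub>v y)"
proof -
  let ?B = "mat_adjoint A"
  have B: "?B \<in> carrier_mat n n" using A by simp
  have Dv: "D *\<^sub>v z = ?B *\<^sub>v (A *\<^sub>v z) - A *\<^sub>v (?B *\<^sub>v z)" if "z \<in> carrier_vec n" for z
    unfolding D_def by (rule self_commutator_mult_vec[OF A that])
  have conj_diff: "conjugate (p - q) = conjugate p - conjugate q"
    if "p \<in> carrier_vec n" "q \<in> carrier_vec n" for p q :: "complex vec"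
    using that by (intro eq_vecI) auto
  have A': "A *\<^sub>v z \<in> carrier_vec n" and B': "?B *\<^sub>v z \<in> carrier_vec n"
    if "z \<in> carrier_vec n" for z
    using mult_mat_vec_carrier[OF A that] mult_mat_vec_carrier[OF B that] by auto
  have "(D *\<^sub>v x) \<bullet>c y = (A *\<^sub>v x) \<bullet>c (A *\<^sub>v y) - (?B *\<^sub>v x) \<bullet>c (?B *\<^sub>v y)"
    unfolding Dv[OF x] using x y A' B' cscalar_prod_adjoint[OF A, of "?B *\<^sub>v x" y]
      cscalar_prod_adjoint[OF B, of "A *\<^sub>v x" y]
    by (simp add: minus_scalar_prod_distrib[of _ n])
  also have "\<dots> = x \<bullet>c (D *\<^sub>v y)"
    unfolding Dv[OF y] using x y A' B' cscalar_prod_adjoint[OF A, of x "A *\<^sub>v y"]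
      cscalar_prod_adjoint[OF B, of x "?B *\<^sub>v y"]
    by (simp add: conj_diff scalar_prod_minus_distrib[of _ n])
  finally show ?thesis .
qed

text \<open>The self-commutator \<open>D\<close> is self-adjoint, whereas \<open>C A - A C\<close> has no visible symmetry; comparing
  the two constrains \<open>A\<close>.  Since
  \<open>D w = ((A w) \<bullet>c v) \<cdot>\<^sub>v u - (w \<bullet>c v) \<cdot>\<^sub>v (A u)\<close>, the identity
  \<open>(D w) \<bullet>c y = w \<bullet>c (D y)\<close> involves only the vectors \<open>u\<close>, \<open>v\<close>, \<open>A u\<close> and
  \<open>A\<^sup>H v\<close> once it is read as an equation in \<open>y\<close>.  A \<open>w\<close> dual to \<open>u\<close> (orthogonal to \<open>v\<close>)
  removes \<open>A u\<close> and leaves \<open>A\<^sup>H v\<close> as a combination of \<open>u\<close> and \<open>v\<close>; a \<open>w\<close> dual to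
  \<open>v\<close> does the same for \<open>A u\<close>.  This is the only place where independence of \<open>u\<close> and \<open>v\<close> enters.\<close>

lemma almost_normal_images:
  assumes A: "A \<in> carrier_mat n n" and u: "u \<in> carrier_vec n"
    and v: "v \<in> carrier_vec n" and v0: "v \<noteq> 0\<^sub>v n" and u0: "u \<noteq> 0\<^sub>v n"
    and ind: "lin_indpt_pair n u v"
    and D: "mat_adjoint A * A - A * mat_adjoint A
      = outer_product n u v * A - A * outer_product n u v"
  shows "A *\<^sub>v u \<in> cspan n {u, v}" and "mat_adjoint A *\<^sub>v v \<in> cspan n {u, v}"
proof -
  have iuv: "u \<noteq> c \<cdot>\<^sub>v v" for c by (rule lin_indpt_pair_not_multiple[OF ind u v])
  have "lin_indpt_pair n v u"
    using ind unfolding lin_indpt_pair_def by (metis insert_commute)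
  then have ivu: "v \<noteq> c \<cdot>\<^sub>v u" for c
    by (rule lin_indpt_pair_not_multiple[OF _ v u])
  have Au: "A *\<^sub>v u \<in> carrier_vec n" and Bv: "mat_adjoint A *\<^sub>v v \<in> carrier_vec n"
    using mult_mat_vec_carrier[OF A u] mult_mat_vec_carrier[OF mat_adjoint_carrier[OF A] v] by auto
  have key: "((A *\<^sub>v w) \<bullet>c v) * (u \<bullet>c y) - (w \<bullet>c v) * ((A *\<^sub>v u) \<bullet>c y)
      = ((mat_adjoint A *\<^sub>v v) \<bullet>c y) * (w \<bullet>c u) - (v \<bullet>c y) * (w \<bullet>c (A *\<^sub>v u))"
    if w: "w \<in> carrier_vec n" and y: "y \<in> carrier_vec n" for w y
  proof -
    let ?D = "mat_adjoint A * A - A * mat_adjoint A"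
    have yA: "A *\<^sub>v y \<in> carrier_vec n" using A y by auto
    have "(?D *\<^sub>v w) \<bullet>c y =
      ((A *\<^sub>v w) \<bullet>c v) * (u \<bullet>c y) - (w \<bullet>c v) * ((A *\<^sub>v u) \<bullet>c y)"
      unfolding almost_normal_mult_vec[OF A u v D w]
      using Au u y by (simp add: minus_scalar_prod_distrib[of _ n])
    moreover have "w \<bullet>c (?D *\<^sub>v y) = cnj ((A *\<^sub>v y) \<bullet>c v) * (w \<bullet>c u) -
        cnj (y \<bullet>c v) * (w \<bullet>c (A *\<^sub>v u))"
    proof -
      have "conjugate (a \<cdot>\<^sub>v u - b \<cdot>\<^sub>v (A *\<^sub>v u)) =
          cnj a \<cdot>\<^sub>v conjugate u - cnj b \<cdot>\<^sub>v conjugate (A *\<^sub>v u)" for a b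
        using u A by (intro eq_vecI) auto
      then show ?thesis
        unfolding almost_normal_mult_vec[OF A u v D y]
        using Au u w by (simp add: scalar_prod_minus_distrib[of _ n])
    qed
    moreover have "cnj ((A *\<^sub>v y) \<bullet>c v) = (mat_adjoint A *\<^sub>v v) \<bullet>c y"
      using cscalar_prod_adjoint[OF A y v] cscalar_prod_conjugate_commute[OF y Bv] by simp
    moreover have "cnj (y \<bullet>c v) = v \<bullet>c y"
      by (rule cscalar_prod_conjugate_commute[OF y v])
    ultimately show ?thesis
      using self_commutator_self_adjoint[OF A w y] by simp
  qed
  obtain w where w: "w \<in> carrier_vec n" "w \<bullet>c u = 1" "w \<bullet>c v = 0"
    using dual_vector[OF u v iuv v0] .
  have "mat_adjoint A *\<^sub>v v
      = ((A *\<^sub>v w) \<bullet>c v) \<cdot>\<^sub>v u + (w \<bullet>c (A *\<^sub>v u)) \<cdot>\<^sub>v v"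
  proof (rule cscalar_prod_nondegenerate[OF Bv])
    fix y :: "complex vec" assume y: "y \<in> carrier_vec n"
    show "(mat_adjoint A *\<^sub>v v) \<bullet>c y
      = (((A *\<^sub>v w) \<bullet>c v) \<cdot>\<^sub>v u + (w \<bullet>c (A *\<^sub>v u)) \<cdot>\<^sub>v v) \<bullet>c y"
      using key[OF w(1) y] w u v y by (simp add: add_scalar_prod_distrib[of _ n] algebra_simps)
  qed (use u v in auto)
  then show "mat_adjoint A *\<^sub>v v \<in> cspan n {u, v}"
    using lincomb_pair_in_cspan[OF u v] by metis
  obtain w' where w': "w' \<in> carrier_vec n" "w' \<bullet>c v = 1" "w' \<bullet>c u = 0"
    using dual_vector[OF v u ivu u0] .
  have "A *\<^sub>v u
      = ((A *\<^sub>v w') \<bullet>c v) \<cdot>\<^sub>v u + (w' \<bullet>c (A *\<^sub>v u)) \<cdot>\<^sub>v v"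
  proof (rule cscalar_prod_nondegenerate[OF Au])
    fix y :: "complex vec" assume y: "y \<in> carrier_vec n"
    show "(A *\<^sub>v u) \<bullet>c y
      = (((A *\<^sub>v w') \<bullet>c v) \<cdot>\<^sub>v u + (w' \<bullet>c (A *\<^sub>v u)) \<cdot>\<^sub>v v) \<bullet>c y"
      using key[OF w'(1) y] w' u v y by (simp add: add_scalar_prod_distrib[of _ n] algebra_simps)
  qed (use u v in auto)
  then show "A *\<^sub>v u \<in> cspan n {u, v}"
    using lincomb_pair_in_cspan[OF u v] by metis
qed

text \<open>The range of \<open>C A - A C\<close> is contained in the span of \<open>u\<close> and \<open>A u\<close>, hence in
  \<open>span {u, v}\<close>: modulo this plane the two parts of \<open>A\<close> commute.\<close>

lemma almost_normal_commutator:
  assumes A: "A \<in> carrier_mat n n" and u: "u \<in> carrier_vec n" "u \<noteq> 0\<^sub>v n"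
    and v: "v \<in> carrier_vec n" "v \<noteq> 0\<^sub>v n"
    and ind: "lin_indpt_pair n u v"
    and D: "mat_adjoint A * A - A * mat_adjoint A
      = outer_product n u v * A - A * outer_product n u v"
    and x: "x \<in> carrier_vec n"
  shows "hermitian_part A *\<^sub>v (antihermitian_part A *\<^sub>v x)
    - antihermitian_part A *\<^sub>v (hermitian_part A *\<^sub>v x) \<in> cspan n {u, v}"
  unfolding commutator_of_parts_eq_half_self_commutator[OF A x]
    almost_normal_mult_vec[OF A u(1) v(1) D x]
  using u v almost_normal_images(1)[OF A u(1) v(1,2) u(2) ind D] cspan_superset[of "{u, v}" n]
  by (intro cspan_smult cspan_diff) auto

text \<open>Because \<open>K u = A u - H u\<close> and \<open>K v = H v - A\<^sup>H v\<close>, where \<open>A u\<close> and \<open>A\<^sup>H v\<close> stay in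
  \<open>span {u, v}\<close>.\<close>

lemma almost_normal_antihermitian_image:
  assumes A: "A \<in> carrier_mat n n" and u: "u \<in> carrier_vec n" "u \<noteq> 0\<^sub>v n"
    and v: "v \<in> carrier_vec n" "v \<noteq> 0\<^sub>v n"
    and ind: "lin_indpt_pair n u v"
    and D: "mat_adjoint A * A - A * mat_adjoint A
      = outer_product n u v * A - A * outer_product n u v"
    and x: "x \<in> {u, v}"
  shows "antihermitian_part A *\<^sub>v x \<in> cspan n ({u, v} \<union> (*\<^sub>v) (hermitian_part A) ` {u, v})"
    (is "?K *\<^sub>v x \<in> cspan n (?S \<union> (*\<^sub>v) ?H ` ?S)")
proof -
  have H: "?H \<in> carrier_mat n n" and K: "?K \<in> carrier_mat n n"
    using A by (auto intro: hermitian_part_carrier antihermitian_part_carrier)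
  have car: "?S \<union> (*\<^sub>v) ?H ` ?S \<subseteq> carrier_vec n" using u v H by auto
  have Hin: "?H *\<^sub>v y \<in> cspan n (?S \<union> (*\<^sub>v) ?H ` ?S)" if "y \<in> ?S" for y
    using cspan_superset[OF car] that by blast
  have Sin: "y \<in> cspan n (?S \<union> (*\<^sub>v) ?H ` ?S)" if "y \<in> cspan n ?S" for y
    using cspan_mono[of ?S] that by blast
  have "?K *\<^sub>v u = A *\<^sub>v u - ?H *\<^sub>v u"
    using add_mult_distrib_mat_vec[OF H K u(1)] hermitian_part_plus_antihermitian_part[OF A] H K u
    by (intro eq_vecI) auto
  moreover have "?K *\<^sub>v v = ?H *\<^sub>v v - mat_adjoint A *\<^sub>v v"
    using minus_mult_distrib_mat_vec[OF H K v(1)]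
      mat_adjoint_eq_hermitian_part_minus_antihermitian_part[OF A] H K v
    by (intro eq_vecI) auto
  moreover have "A *\<^sub>v u - ?H *\<^sub>v u \<in> cspan n (?S \<union> (*\<^sub>v) ?H ` ?S)"
    by (intro cspan_diff[OF car] Hin Sin almost_normal_images[OF A u(1) v(1,2) u(2) ind D]) simp
  moreover have "?H *\<^sub>v v - mat_adjoint A *\<^sub>v v \<in> cspan n (?S \<union> (*\<^sub>v) ?H ` ?S)"
    by (intro cspan_diff[OF car] Hin Sin almost_normal_images[OF A u(1) v(1,2) u(2) ind D]) simp
  ultimately show ?thesis using x by (metis insertE singletonD)
qed

section \<open>Filtrations generated by a linear map\<close>

text \<open>The inductive core, in a form that serves both Krylov subspaces and Lanczos blocks.  The sets
  \<open>G k\<close> generate an increasing chain of subspaces that starts with the span of \<open>S\<close>; \<open>H\<close> moves each of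
  them at most one step up, and each is reached from its predecessor by one application of \<open>H\<close>.
  A generator at level \<open>k + 1\<close> is a combination of vectors \<open>y\<close> and \<open>H z\<close> with \<open>y\<close>, \<open>z\<close> at level
  \<open>k\<close>.  By induction \<open>K y\<close> and \<open>K z\<close> lie at level \<open>k + 1\<close>, and
  \<open>K (H z) = H (K z) - (H K - K H) z\<close> differs from \<open>H (K z)\<close>, a vector of level \<open>k + 2\<close>, only by
  an element of the span of \<open>S\<close>.

  The chain hypotheses are bounded by \<open>m\<close> because a Lanczos run supplies only finitely many levels.\<close>

lemma commuting_modulo_start_respects_filtration:
  fixes G :: "nat \<Rightarrow> complex vec set"
  assumes H: "H \<in> carrier_mat n n" and K: "K \<in> carrier_mat n n"
    and S: "S \<subseteq> carrier_vec n" and G: "\<And>k. G k \<subseteq> carrier_vec n"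
    and G0: "cspan n (G 0) = cspan n S"
    and mono: "\<And>k. k < m \<Longrightarrow> G k \<subseteq> cspan n (G (Suc k))"
    and up: "\<And>k x. k < m \<Longrightarrow> x \<in> G k \<Longrightarrow> H *\<^sub>v x \<in> cspan n (G (Suc k))"
    and gen: "\<And>k. Suc k < m \<Longrightarrow> G (Suc k) \<subseteq> cspan n (G k \<union> (*\<^sub>v) H ` G k)"
    and base: "\<And>x. x \<in> S \<Longrightarrow> K *\<^sub>v x \<in> cspan n (S \<union> (*\<^sub>v) H ` S)"
    and comm: "\<And>x. x \<in> carrier_vec n \<Longrightarrow> H *\<^sub>v (K *\<^sub>v x) - K *\<^sub>v (H *\<^sub>v x) \<in> cspan n S"
  shows "k < m \<Longrightarrow> x \<in> cspan n (G k) \<Longrightarrow> K *\<^sub>v x \<in> cspan n (G (Suc k))"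
proof (induction k arbitrary: x)
  case 0
  have up0: "H *\<^sub>v x \<in> cspan n (G 1)" if "x \<in> cspan n (G 0)" for x
    using mult_mat_vec_cspan[OF H G G up that] 0(1) by simp
  have S0: "S \<subseteq> cspan n (G 0)" using cspan_superset[OF S] G0 by simp
  have mono0: "cspan n (G 0) \<subseteq> cspan n (G 1)"
    using cspan_minimal[OF G mono[OF 0(1)]] by simp
  have "S \<union> (*\<^sub>v) H ` S \<subseteq> cspan n (G 1)"
    using S0 up0 mono0 by blast
  then have "cspan n (S \<union> (*\<^sub>v) H ` S) \<subseteq> cspan n (G 1)"
    by (rule cspan_minimal[OF G])
  with base have "K *\<^sub>v x \<in> cspan n (G 1)" if "x \<in> S" for x using that by blast
  then have "K *\<^sub>v x \<in> cspan n (G 1)" if "x \<in> cspan n S" for x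
    using mult_mat_vec_cspan[OF K S G _ that] by blast
  then show ?case using 0(2) G0 by simp
next
  case (Suc k)
  have k: "k < m" using Suc.prems by simp
  have step: "cspan n (G i) \<subseteq> cspan n (G (Suc i))" if "i < m" for i
    by (rule cspan_minimal[OF G mono[OF that]])
  have "cspan n (G 0) \<subseteq> cspan n (G i)" if "i \<le> m" for i
    using that
  proof (induction i)
    case (Suc i)
    then show ?case using step[of i] by (meson Suc_leD Suc_le_lessD subset_trans)
  qed simp
  then have S_sub: "cspan n S \<subseteq> cspan n (G (Suc (Suc k)))"
    using G0 Suc.prems(1) by (metis Suc_leI)
  have HG: "(*\<^sub>v) H ` G k \<subseteq> carrier_vec n"
    using mult_mat_vec_carrier[OF H] G by blast
  have gens: "G k \<union> (*\<^sub>v) H ` G k \<subseteq> carrier_vec n" using HG G by simp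
  have "K *\<^sub>v y \<in> cspan n (G (Suc (Suc k)))" if y: "y \<in> G k \<union> (*\<^sub>v) H ` G k" for y
    using y
  proof
    assume "y \<in> G k"
    then have "K *\<^sub>v y \<in> cspan n (G (Suc k))"
      using Suc.IH[OF k] cspan_superset[OF G] by blast
    then show ?thesis using step[OF Suc.prems(1)] by blast
  next
    assume "y \<in> (*\<^sub>v) H ` G k"
    then obtain z where z: "z \<in> G k" and y: "y = H *\<^sub>v z" by blast
    have zc: "z \<in> carrier_vec n" using z G by blast
    have "K *\<^sub>v z \<in> cspan n (G (Suc k))"
      using Suc.IH[OF k] cspan_superset[OF G] z by blast
    then have "H *\<^sub>v (K *\<^sub>v z) \<in> cspan n (G (Suc (Suc k)))"
      using mult_mat_vec_cspan[OF H G[of "Suc k"] G[of "Suc (Suc k)"]] up[OF Suc.prems(1)] by blast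
    moreover have "H *\<^sub>v (K *\<^sub>v z) - K *\<^sub>v (H *\<^sub>v z) \<in> cspan n (G (Suc (Suc k)))"
      using comm[OF zc] S_sub by blast
    ultimately have "H *\<^sub>v (K *\<^sub>v z) - (H *\<^sub>v (K *\<^sub>v z) - K *\<^sub>v (H *\<^sub>v z))
        \<in> cspan n (G (Suc (Suc k)))"
      by (rule cspan_diff[OF G])
    moreover have "H *\<^sub>v (K *\<^sub>v z) - (H *\<^sub>v (K *\<^sub>v z) - K *\<^sub>v (H *\<^sub>v z)) = K *\<^sub>v y"
      using H K zc y by (intro eq_vecI) auto
    ultimately show ?thesis by simp
  qed
  then have "K *\<^sub>v y \<in> cspan n (G (Suc (Suc k)))" if "y \<in> G (Suc k)" for y
    using mult_mat_vec_cspan[OF K gens G] gen[OF Suc.prems(1)] that by blast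
  then show ?case
    by (rule mult_mat_vec_cspan[OF K G G _ Suc.prems(2)])
qed

section \<open>Krylov subspaces\<close>

definition krylov_generators :: "nat \<Rightarrow> complex mat \<Rightarrow> complex mat \<Rightarrow> complex vec set" where
  "krylov_generators j H Z = (\<Union>i<j. set (cols (H ^\<^sub>m i * Z)))"

lemma krylov_eq: "krylov n j H Z = cspan n (krylov_generators j H Z)"
  by (simp add: krylov_def krylov_generators_def)

lemma krylov_generators_carrier:
  assumes "H \<in> carrier_mat n n" "Z \<in> carrier_mat n l"
  shows "krylov_generators j H Z \<subseteq> carrier_vec n"
proof -
  have "set (cols (H ^\<^sub>m i * Z)) \<subseteq> carrier_vec n" for i
    using cols_dim[of "H ^\<^sub>m i * Z"] assms by simp
  then show ?thesis by (auto simp: krylov_generators_def)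
qed

lemma set_cols_mult:
  assumes M: "M \<in> carrier_mat n n" and Z: "Z \<in> carrier_mat n l"
  shows "set (cols (M * Z)) = (*\<^sub>v) M ` set (cols Z)"
proof -
  have "cols (M * Z) = map ((*\<^sub>v) M) (cols Z)"
  proof (rule nth_equalityI)
    fix j assume "j < length (cols (M * Z))"
    then have j: "j < l" using Z by simp
    then show "cols (M * Z) ! j = map ((*\<^sub>v) M) (cols Z) ! j"
      using col_mult2[OF M Z j] Z by (simp del: col_mult)
  qed simp
  then show ?thesis by simp
qed

lemma pow_mat_Suc_left:
  assumes "H \<in> carrier_mat n n"
  shows "H ^\<^sub>m Suc i = H * H ^\<^sub>m i"
proof (induction i)
  case 0
  then show ?case using assms by simp
next
  case (Suc i)
  have "H ^\<^sub>m i \<in> carrier_mat n n" using assms by simp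
  then show ?case
    using Suc assms by (metis assoc_mult_mat pow_mat.simps(2))
qed

lemma set_cols_pow_Suc:
  assumes H: "H \<in> carrier_mat n n" and Z: "Z \<in> carrier_mat n l"
  shows "set (cols (H ^\<^sub>m Suc i * Z)) = (*\<^sub>v) H ` set (cols (H ^\<^sub>m i * Z))"
proof -
  have P: "H ^\<^sub>m i \<in> carrier_mat n n" using H by simp
  have "H ^\<^sub>m Suc i * Z = H * (H ^\<^sub>m i * Z)"
    unfolding pow_mat_Suc_left[OF H] by (rule assoc_mult_mat[OF H P Z])
  then show ?thesis
    using set_cols_mult[OF H mult_carrier_mat[OF P Z]] by simp
qed

text \<open>Krylov subspaces form a chain of the kind just considered, with level \<open>k\<close> given by
  \<open>krylov_generators (Suc k) H Z\<close>.\<close>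

lemma krylov_filtration:
  assumes H: "H \<in> carrier_mat n n" and Z: "Z \<in> carrier_mat n l"
  shows krylov_generators_one: "krylov_generators (Suc 0) H Z = set (cols Z)"
    and krylov_generators_mono: "i \<le> j \<Longrightarrow> krylov_generators i H Z \<subseteq> krylov_generators j H Z"
    and krylov_generators_mult: "x \<in> krylov_generators j H Z \<Longrightarrow>
        H *\<^sub>v x \<in> krylov_generators (Suc j) H Z"
    and krylov_generators_Suc_Suc: "krylov_generators (Suc (Suc j)) H Z
      \<subseteq> krylov_generators (Suc j) H Z \<union> (*\<^sub>v) H ` krylov_generators (Suc j) H Z"
proof -
  show "krylov_generators (Suc 0) H Z = set (cols Z)"
    using H Z by (simp add: krylov_generators_def lessThan_Suc left_mult_one_mat[OF Z])
  show "i \<le> j \<Longrightarrow> krylov_generators i H Z \<subseteq> krylov_generators j H Z"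
    unfolding krylov_generators_def by (intro UN_mono) auto
  show "H *\<^sub>v x \<in> krylov_generators (Suc j) H Z" if x: "x \<in> krylov_generators j H Z"
  proof -
    obtain i where i: "i < j" "x \<in> set (cols (H ^\<^sub>m i * Z))"
      using x unfolding krylov_generators_def by blast
    then have "H *\<^sub>v x \<in> set (cols (H ^\<^sub>m Suc i * Z))"
      unfolding set_cols_pow_Suc[OF H Z] by blast
    then show ?thesis using i(1) unfolding krylov_generators_def by blast
  qed
  show "krylov_generators (Suc (Suc j)) H Z
      \<subseteq> krylov_generators (Suc j) H Z \<union> (*\<^sub>v) H ` krylov_generators (Suc j) H Z"
  proof
    fix x assume "x \<in> krylov_generators (Suc (Suc j)) H Z"
    then obtain i where i: "i < Suc (Suc j)" "x \<in> set (cols (H ^\<^sub>m i * Z))"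
      by (auto simp: krylov_generators_def)
    show "x \<in> krylov_generators (Suc j) H Z \<union> (*\<^sub>v) H ` krylov_generators (Suc j) H Z"
    proof (cases i)
      case 0
      then show ?thesis
        using i(2) unfolding krylov_generators_def by (intro UnI1 UN_I[of 0]) auto
    next
      case (Suc i')
      then have "x \<in> (*\<^sub>v) H ` set (cols (H ^\<^sub>m i' * Z))"
        using i(2) set_cols_pow_Suc[OF H Z, of i'] by simp
      then show ?thesis using i(1) Suc by (auto simp: krylov_generators_def)
    qed
  qed
qed

text \<open>The \<open>i\<close>-th power of \<open>K\<close> maps the common starting space to level \<open>i\<close> of the Krylov chain of
  \<open>H\<close>, one level per factor.  The two block starting matrices matter only through their column space.\<close>

lemma krylov_subset_krylov:
  assumes H: "H \<in> carrier_mat n n" and K: "K \<in> carrier_mat n n" and S: "S \<subseteq> carrier_vec n"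
    and X: "X \<in> carrier_mat n l" "column_space n X = cspan n S"
    and Y: "Y \<in> carrier_mat n m" "column_space n Y = cspan n S"
    and base: "\<And>x. x \<in> S \<Longrightarrow> K *\<^sub>v x \<in> cspan n (S \<union> (*\<^sub>v) H ` S)"
    and comm: "\<And>x. x \<in> carrier_vec n \<Longrightarrow> H *\<^sub>v (K *\<^sub>v x) - K *\<^sub>v (H *\<^sub>v x) \<in> cspan n S"
  shows "krylov n j K X \<subseteq> krylov n j H Y"
proof -
  define G where "G k = krylov_generators (Suc k) H Y" for k
  have Gc: "G k \<subseteq> carrier_vec n" for k
    unfolding G_def by (rule krylov_generators_carrier[OF H Y(1)])
  have Xc: "set (cols X) \<subseteq> carrier_vec n" using cols_dim[of X] X by auto
  have G0: "cspan n (G 0) = cspan n S"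
    using Y(2) krylov_generators_one[OF H Y(1)] unfolding G_def column_space_eq_cspan_cols by simp
  have shift: "K *\<^sub>v x \<in> cspan n (G (Suc k))" if x: "x \<in> cspan n (G k)" for k x
  proof (rule commuting_modulo_start_respects_filtration
        [where G = G and m = "Suc k", OF H K S Gc G0 _ _ _ base comm])
    show "G i \<subseteq> cspan n (G (Suc i))" for i
      using krylov_generators_mono[OF H Y(1), of "Suc i" "Suc (Suc i)"] cspan_superset[OF Gc]
      unfolding G_def by fastforce
    show "H *\<^sub>v y \<in> cspan n (G (Suc i))" if "y \<in> G i" for i y
      using krylov_generators_mult[OF H Y(1)] that cspan_superset[OF Gc]
      unfolding G_def by blast
    show "G (Suc i) \<subseteq> cspan n (G i \<union> (*\<^sub>v) H ` G i)" for i
    proof -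
      have "(*\<^sub>v) H ` G i \<subseteq> carrier_vec n"
        using mult_mat_vec_carrier[OF H] Gc by blast
      then have "G i \<union> (*\<^sub>v) H ` G i \<subseteq> cspan n (G i \<union> (*\<^sub>v) H ` G i)"
        using Gc by (intro cspan_superset) simp
      then show ?thesis
        using krylov_generators_Suc_Suc[OF H Y(1), of i] unfolding G_def by blast
    qed
  qed (use x in auto)
  have powers: "set (cols (K ^\<^sub>m i * X)) \<subseteq> cspan n (G i)" for i
  proof (induction i)
    case 0
    have "set (cols X) \<subseteq> cspan n (set (cols X))" by (rule cspan_superset[OF Xc])
    then show ?case
      using X G0 K unfolding column_space_eq_cspan_cols by (simp add: left_mult_one_mat[OF X(1)])
  next
    case (Suc i)
    then show ?case unfolding set_cols_pow_Suc[OF K X(1)] using shift by blast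
  qed
  have "krylov_generators j K X \<subseteq> krylov n j H Y"
  proof
    fix x assume "x \<in> krylov_generators j K X"
    then obtain i where i: "i < j" "x \<in> set (cols (K ^\<^sub>m i * X))"
      by (auto simp: krylov_generators_def)
    then have "x \<in> cspan n (G i)" using powers by blast
    moreover have "cspan n (G i) \<subseteq> krylov n j H Y"
      unfolding krylov_eq G_def using i(1)
      by (intro cspan_mono krylov_generators_mono[OF H Y(1)]) simp
    ultimately show "x \<in> krylov n j H Y" by blast
  qed
  then show ?thesis
    unfolding krylov_eq by (rule cspan_minimal[OF krylov_generators_carrier[OF H Y(1)]])
qed

section \<open>Orthonormal systems\<close>

text \<open>The identity of size \<open>q\<close> cannot factor through a space of smaller dimension: padding both factors
  with zeros to square matrices, a left inverse is also a right inverse, but a product whose left factor has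
  a zero row is not the identity.  All dimension counts below, namely the block sizes and the squareness
  of the assembled matrix, reduce to this.\<close>

lemma one_mat_factorization_dim_le:
  fixes X Y :: "'a :: field mat"
  assumes X: "X \<in> carrier_mat q m" and Y: "Y \<in> carrier_mat m q" and XY: "X * Y = 1\<^sub>m q"
  shows "q \<le> m"
proof (rule ccontr)
  assume "\<not> q \<le> m"
  then have mq: "m < q" by simp
  define X' where "X' = mat q q (\<lambda>(i, j). if j < m then X $$ (i, j) else 0)"
  define Y' where "Y' = mat q q (\<lambda>(i, j). if i < m then Y $$ (i, j) else 0)"
  have carr: "X' \<in> carrier_mat q q" "Y' \<in> carrier_mat q q" by (auto simp: X'_def Y'_def)
  have "X' * Y' = X * Y"
  proof (rule eq_matI)
    fix i j assume "i < dim_row (X * Y)" "j < dim_col (X * Y)"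
    then have ij: "i < q" "j < q" using X Y by auto
    have "(X' * Y') $$ (i, j) = (\<Sum>k\<in>{0..<q}. X' $$ (i, k) * Y' $$ (k, j))"
      using ij carr by (simp add: scalar_prod_def)
    also have "\<dots> = (\<Sum>k\<in>{0..<m}. X $$ (i, k) * Y $$ (k, j))"
      using ij mq by (intro sum.mono_neutral_cong_right) (auto simp: X'_def Y'_def)
    also have "\<dots> = (X * Y) $$ (i, j)"
      using ij X Y by (simp add: scalar_prod_def)
    finally show "(X' * Y') $$ (i, j) = (X * Y) $$ (i, j)" .
  qed (use X Y carr in auto)
  then have "Y' * X' = 1\<^sub>m q"
    using mat_mult_left_right_inverse[OF carr] XY by simp
  moreover have "(Y' * X') $$ (m, m) = 0"
    using mq by (simp add: scalar_prod_def Y'_def X'_def)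
  ultimately show False using mq by simp
qed

text \<open>Writing \<open>Q = M B\<close> turns \<open>Q\<^sup>H Q = 1\<close> into the factorization \<open>(Q\<^sup>H M) B = 1\<close>
  through dimension \<open>m\<close>.\<close>

lemma orthonormal_cols_dim_le:
  assumes Q: "Q \<in> carrier_mat n q" "mat_adjoint Q * Q = 1\<^sub>m q"
    and M: "M \<in> carrier_mat n m" and sub: "column_space n Q \<subseteq> column_space n M"
  shows "q \<le> m"
proof -
  have "\<exists>x \<in> carrier_vec m. M *\<^sub>v x = col Q j" if "j < q" for j
  proof -
    have "set (cols Q) \<subseteq> carrier_vec n" using cols_dim[of Q] Q by auto
    then have "set (cols Q) \<subseteq> column_space n Q"
      unfolding column_space_eq_cspan_cols by (rule cspan_superset)
    moreover have "col Q j \<in> set (cols Q)" using that Q(1) by (auto simp: cols_def)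
    ultimately show ?thesis using sub column_space_iff[OF M] by blast
  qed
  then have "\<forall>j. \<exists>x. j < q \<longrightarrow> x \<in> carrier_vec m \<and> M *\<^sub>v x = col Q j" by blast
  from choice[OF this] obtain b where
    "\<forall>j. j < q \<longrightarrow> b j \<in> carrier_vec m \<and> M *\<^sub>v b j = col Q j" by (rule exE)
  then have b: "b j \<in> carrier_vec m" "M *\<^sub>v b j = col Q j" if "j < q" for j
    using that by simp_all
  define B where "B = mat_of_cols m (map b [0..<q])"
  have B: "B \<in> carrier_mat m q"
    unfolding B_def using mat_of_cols_carrier(1)[of m "map b [0..<q]"] by simp
  have "Q = M * B"
  proof (rule mat_col_eqI)
    fix j assume "j < dim_col (M * B)"
    then have j: "j < q" using B by simp
    then have "col B j = b j" unfolding B_def using b by (subst col_mat_of_cols) auto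
    then show "col Q j = col (M * B) j" using col_mult2[OF M B j] b(2)[OF j] by simp
  qed (use Q(1) M B in auto)
  then have "(mat_adjoint Q * M) * B = 1\<^sub>m q"
    using assoc_mult_mat[OF mat_adjoint_carrier[OF Q(1)] M B] Q(2) by simp
  then show ?thesis
    by (rule one_mat_factorization_dim_le[OF mult_carrier_mat[OF mat_adjoint_carrier[OF Q(1)] M] B])
qed

lemma orthonormal_cols_dim_le_2:
  assumes Q: "Q \<in> carrier_mat n q" "mat_adjoint Q * Q = 1\<^sub>m q"
    and u: "u \<in> carrier_vec n" and v: "v \<in> carrier_vec n"
    and sub: "column_space n Q \<subseteq> cspan n {u, v}"
  shows "q \<le> 2"
proof (rule orthonormal_cols_dim_le[OF Q])
  show "mat_of_cols n [u, v] \<in> carrier_mat n 2"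
    using mat_of_cols_carrier(1)[of n "[u, v]"] by (simp add: numeral_2_eq_2)
  have "cols (mat_of_cols n [u, v]) = [u, v]" using u v by simp
  then show "column_space n Q \<subseteq> column_space n (mat_of_cols n [u, v])"
    using sub unfolding column_space_eq_cspan_cols[of n "mat_of_cols n [u, v]"] by simp
qed

definition orthonormal_list :: "complex vec list \<Rightarrow> bool" where
  "orthonormal_list xs \<longleftrightarrow>
     (\<forall>a < length xs. \<forall>b < length xs. xs ! a \<bullet>c xs ! b = (if a = b then 1 else 0))"

lemma orthonormal_list_append:
  assumes xs: "orthonormal_list xs" and ys: "orthonormal_list ys"
    and xy: "\<And>x y. x \<in> set xs \<Longrightarrow> y \<in> set ys \<Longrightarrow> x \<bullet>c y = 0 \<and> y \<bullet>c x = 0"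
  shows "orthonormal_list (xs @ ys)"
  unfolding orthonormal_list_def
proof (intro allI impI)
  fix a b assume a: "a < length (xs @ ys)" and b: "b < length (xs @ ys)"
  consider (ll) "a < length xs" "b < length xs" | (lr) "a < length xs" "\<not> b < length xs"
    | (rl) "\<not> a < length xs" "b < length xs" | (rr) "\<not> a < length xs" "\<not> b < length xs"
    by blast
  then show "(xs @ ys) ! a \<bullet>c (xs @ ys) ! b = (if a = b then 1 else 0)"
  proof cases
    case ll
    then show ?thesis using xs by (simp add: orthonormal_list_def nth_append)
  next
    case lr
    then have "xs ! a \<in> set xs" "ys ! (b - length xs) \<in> set ys" "a \<noteq> b" using b by auto
    then show ?thesis using lr xy by (simp add: nth_append)
  next
    case rl
    then have "xs ! b \<in> set xs" "ys ! (a - length xs) \<in> set ys" "a \<noteq> b" using a by auto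
    then show ?thesis using rl xy by (simp add: nth_append)
  next
    case rr
    then have "a - length xs < length ys" "b - length xs < length ys"
      "a - length xs = b - length xs \<longleftrightarrow> a = b" using a b by auto
    then show ?thesis using rr ys by (simp add: orthonormal_list_def nth_append)
  qed
qed

lemma gram_entry:
  assumes Q: "Q \<in> carrier_mat n q" and a: "a < q" and b: "b < q"
  shows "(mat_adjoint Q * Q) $$ (a, b) = col Q b \<bullet>c col Q a"
  using assms by (simp add: conjugate_vec_sprod_comm[of _ n])

lemma orthonormal_list_cols:
  assumes Q: "Q \<in> carrier_mat n q" and I: "mat_adjoint Q * Q = 1\<^sub>m q"
  shows "orthonormal_list (cols Q)"
  unfolding orthonormal_list_def
proof (intro allI impI)
  fix a b assume "a < length (cols Q)" "b < length (cols Q)"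
  then have ab: "a < q" "b < q" using Q by auto
  then show "cols Q ! a \<bullet>c cols Q ! b = (if a = b then 1 else 0)"
    using gram_entry[OF Q ab(2,1)] Q unfolding I by auto
qed

lemma orthonormal_list_mat_of_cols:
  assumes xs: "set xs \<subseteq> carrier_vec n" and o: "orthonormal_list xs"
  shows "mat_adjoint (mat_of_cols n xs) * mat_of_cols n xs = 1\<^sub>m (length xs)"
proof (rule eq_matI)
  fix a b assume "a < dim_row (1\<^sub>m (length xs) :: complex mat)" "b < dim_col (1\<^sub>m (length xs) :: complex mat)"
  then have ab: "a < length xs" "b < length xs" by auto
  have "col (mat_of_cols n xs) i = xs ! i" if "i < length xs" for i
    using that xs by (intro col_mat_of_cols) auto
  then show "(mat_adjoint (mat_of_cols n xs) * mat_of_cols n xs) $$ (a, b) = 1\<^sub>m (length xs) $$ (a, b)"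
    using gram_entry[OF mat_of_cols_carrier(1) ab, of n] o ab by (auto simp: orthonormal_list_def)
qed auto

lemma mult_mat_vec_in_cspan_cols:
  fixes Q :: "complex mat"
  assumes Q: "Q \<in> carrier_mat n q" and t: "t \<in> carrier_vec q"
  shows "Q *\<^sub>v t \<in> cspan n (set (cols Q))"
  using column_space_iff[OF Q] t unfolding column_space_eq_cspan_cols by blast

text \<open>\<open>Q Q\<^sup>H\<close> is the orthogonal projection onto the column space of \<open>Q\<close>, so it is invisible to
  inner products with columns of \<open>Q\<close>.\<close>

lemma projection_cscalar_prod:
  fixes Q :: "complex mat"
  assumes Q: "Q \<in> carrier_mat n q" and I: "mat_adjoint Q * Q = 1\<^sub>m q"
    and z: "z \<in> carrier_vec n" and y: "y \<in> set (cols Q)"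
  shows "(Q *\<^sub>v (mat_adjoint Q *\<^sub>v z)) \<bullet>c y = z \<bullet>c y"
proof -
  obtain j where j: "j < q" and yj: "y = col Q j"
    using y Q by (auto simp: cols_def)
  define e where "e = (unit_vec q j :: complex vec)"
  have e: "e \<in> carrier_vec q" by (simp add: e_def)
  have ye: "y = Q *\<^sub>v e"
    unfolding yj e_def using Q j by (intro eq_vecI) auto
  have yc: "y \<in> carrier_vec n" unfolding ye by (rule mult_mat_vec_carrier[OF Q e])
  note Q' = mat_adjoint_carrier[OF Q]
  have Qz: "mat_adjoint Q *\<^sub>v z \<in> carrier_vec q" by (rule mult_mat_vec_carrier[OF Q' z])
  have "mat_adjoint Q *\<^sub>v y = e"
    unfolding ye assoc_mult_mat_vec[OF Q' Q e, symmetric] I using e by simp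
  then have "(Q *\<^sub>v (mat_adjoint Q *\<^sub>v z)) \<bullet>c y = (mat_adjoint Q *\<^sub>v z) \<bullet>c e"
    using cscalar_prod_adjoint[OF Q Qz yc] by simp
  also have "\<dots> = z \<bullet>c y"
    using cscalar_prod_adjoint[OF Q' z e] ye by simp
  finally show ?thesis .
qed

section \<open>Block tridiagonality\<close>

definition block_columns :: "complex mat list \<Rightarrow> nat \<Rightarrow> complex vec set" where
  "block_columns Us k = (\<Union>i\<le>k. set (cols (Us ! i)))"

definition orthonormal_blocks :: "nat \<Rightarrow> complex mat list \<Rightarrow> bool" where
  "orthonormal_blocks n Us \<longleftrightarrow>
     (\<forall>i < length Us. Us ! i \<in> carrier_mat n (dim_col (Us ! i)) \<and>
        mat_adjoint (Us ! i) * Us ! i = 1\<^sub>m (dim_col (Us ! i))) \<and>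
     (\<forall>i < length Us. \<forall>j < length Us. i \<noteq> j \<longrightarrow>
        (\<forall>x \<in> set (cols (Us ! i)). \<forall>y \<in> set (cols (Us ! j)). x \<bullet>c y = 0))"

lemma orthonormal_blocksD:
  assumes "orthonormal_blocks n Us"
  shows "i < length Us \<Longrightarrow> Us ! i \<in> carrier_mat n (dim_col (Us ! i))"
    and "i < length Us \<Longrightarrow> mat_adjoint (Us ! i) * Us ! i = 1\<^sub>m (dim_col (Us ! i))"
    and "i < length Us \<Longrightarrow> set (cols (Us ! i)) \<subseteq> carrier_vec n"
    and "i < length Us \<Longrightarrow> j < length Us \<Longrightarrow> i \<noteq> j \<Longrightarrow> x \<in> set (cols (Us ! i)) \<Longrightarrow>
      y \<in> set (cols (Us ! j)) \<Longrightarrow> x \<bullet>c y = 0"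
proof -
  show car: "Us ! i \<in> carrier_mat n (dim_col (Us ! i))" if "i < length Us" for i
    using assms that by (auto simp: orthonormal_blocks_def)
  show "set (cols (Us ! i)) \<subseteq> carrier_vec n" if "i < length Us" for i
    using cols_dim[of "Us ! i"] car[OF that] by auto
qed (use assms in \<open>auto simp: orthonormal_blocks_def\<close>)

lemma block_columns_carrier:
  "orthonormal_blocks n Us \<Longrightarrow> k < length Us \<Longrightarrow> block_columns Us k \<subseteq> carrier_vec n"
  unfolding block_columns_def using orthonormal_blocksD(3) by (intro UN_least) simp

lemma block_columns_Suc:
  "block_columns Us (Suc k) = block_columns Us k \<union> set (cols (Us ! Suc k))"
  by (auto simp: block_columns_def atMost_Suc)

lemma block_columns_orthogonal:
  assumes Us: "orthonormal_blocks n Us" and k: "k < i" and i: "i < length Us"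
    and y: "y \<in> set (cols (Us ! i))" and x: "x \<in> cspan n (block_columns Us k)"
  shows "x \<bullet>c y = 0"
proof (rule cspan_orthogonal[OF _ _ _ x])
  show "block_columns Us k \<subseteq> carrier_vec n"
    using block_columns_carrier[OF Us] k i by simp
  show "y \<in> carrier_vec n" using orthonormal_blocksD(3)[OF Us i] y by blast
  fix x assume "x \<in> block_columns Us k"
  then obtain j where "j \<le> k" "x \<in> set (cols (Us ! j))" by (auto simp: block_columns_def)
  then show "x \<bullet>c y = 0"
    using orthonormal_blocksD(4)[OF Us, of j i x y] k i y by simp
qed

lemma concat_cols_carrier:
  assumes "orthonormal_blocks n Us"
  shows "set (concat (map cols Us)) \<subseteq> carrier_vec n"
proof
  fix x assume "x \<in> set (concat (map cols Us))"
  then obtain Q where "Q \<in> set Us" and x: "x \<in> set (cols Q)" by auto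
  then obtain i where "i < length Us" "Us ! i = Q" by (meson in_set_conv_nth)
  then show "x \<in> carrier_vec n" using orthonormal_blocksD(3)[OF assms, of i] x by auto
qed

lemma length_concat_cols:
  "length (concat (map cols Us)) = sum_list (block_sizes Us)"
  by (simp add: length_concat block_sizes_def comp_def)

lemma orthonormal_list_concat_cols:
  assumes Us: "orthonormal_blocks n Us"
  shows "orthonormal_list (concat (map cols Us))"
proof -
  have "orthonormal_list (concat (map cols (take k Us)))" if "k \<le> length Us" for k
    using that
  proof (induction k)
    case 0
    then show ?case by (simp add: orthonormal_list_def)
  next
    case (Suc k)
    then have k: "k < length Us" by simp
    have "x \<bullet>c y = 0 \<and> y \<bullet>c x = 0"
      if x: "x \<in> set (concat (map cols (take k Us)))" and y: "y \<in> set (cols (Us ! k))" for x y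
    proof -
      obtain j where "j < k" "x \<in> set (cols (Us ! j))"
      proof -
        obtain Q where "Q \<in> set (take k Us)" and xQ: "x \<in> set (cols Q)" using x by auto
        then obtain j where "j < length (take k Us)" "take k Us ! j = Q" by (meson in_set_conv_nth)
        then show thesis using that[of j] xQ by simp
      qed
      then show ?thesis
        using orthonormal_blocksD(4)[OF Us, of j k x y] orthonormal_blocksD(4)[OF Us, of k j y x] k y
        by simp
    qed
    moreover have "concat (map cols (take (Suc k) Us))
        = concat (map cols (take k Us)) @ cols (Us ! k)"
      using k by (simp add: take_Suc_conv_app_nth)
    moreover have "orthonormal_list (cols (Us ! k))"
      using orthonormal_blocksD(1,2)[OF Us k] by (rule orthonormal_list_cols)
    ultimately show ?case
      using Suc k orthonormal_list_append[of "concat (map cols (take k Us))" "cols (Us ! k)"] by simp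
  qed
  from this[of "length Us"] show ?thesis by simp
qed

lemma concat_blocks_isometry:
  assumes Us: "orthonormal_blocks n Us"
  shows "concat_blocks n Us \<in> carrier_mat n (sum_list (block_sizes Us))"
    and "mat_adjoint (concat_blocks n Us) * concat_blocks n Us = 1\<^sub>m (sum_list (block_sizes Us))"
  using orthonormal_list_mat_of_cols[OF concat_cols_carrier[OF Us] orthonormal_list_concat_cols[OF Us]]
    mat_of_cols_carrier(1)[of n "concat (map cols Us)"]
  unfolding concat_blocks_def length_concat_cols by simp_all

lemma concat_blocks_unitary:
  assumes Us: "orthonormal_blocks n Us" and ge: "n \<le> sum_list (block_sizes Us)"
  shows "unitary n (concat_blocks n Us)"
proof -
  note U = concat_blocks_isometry[OF Us]
  have "sum_list (block_sizes Us) \<le> n"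
    by (rule one_mat_factorization_dim_le[OF mat_adjoint_carrier[OF U(1)] U])
  then have eq: "sum_list (block_sizes Us) = n" using ge by simp
  note U' = U[unfolded eq]
  show "unitary n (concat_blocks n Us)"
    unfolding unitary_def using U' mat_mult_left_right_inverse[OF mat_adjoint_carrier[OF U'(1)] U']
    by simp
qed

lemma concat_cols_nth:
  assumes i: "i < length Us" and r: "r < dim_col (Us ! i)"
  shows "concat (map cols Us) ! (sum_list (take i (block_sizes Us)) + r) = col (Us ! i) r"
    and "sum_list (take i (block_sizes Us)) + r < sum_list (block_sizes Us)"
proof -
  have "concat (map cols Us) ! (sum_list (take i (block_sizes Us)) + r) = col (Us ! i) r \<and>
      sum_list (take i (block_sizes Us)) + r < sum_list (block_sizes Us)"
    using assms
  proof (induction Us arbitrary: i)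
    case (Cons Q Us)
    show ?case
    proof (cases i)
      case 0
      then show ?thesis using Cons.prems by (simp add: block_sizes_def nth_append)
    next
      case (Suc k)
      then show ?thesis using Cons.IH[of k] Cons.prems by (simp add: block_sizes_def nth_append)
    qed
  qed simp
  then show "concat (map cols Us) ! (sum_list (take i (block_sizes Us)) + r) = col (Us ! i) r"
    and "sum_list (take i (block_sizes Us)) + r < sum_list (block_sizes Us)" by auto
qed

lemma compression_entry:
  assumes M: "M \<in> carrier_mat n n" and xs: "set xs \<subseteq> carrier_vec n"
    and a: "a < length xs" and b: "b < length xs"
  shows "(mat_adjoint (mat_of_cols n xs) * M * mat_of_cols n xs) $$ (a, b)
    = (M *\<^sub>v (xs ! b)) \<bullet>c (xs ! a)"
proof -
  let ?U = "mat_of_cols n xs"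
  have U: "?U \<in> carrier_mat n (length xs)" by simp
  have cols: "col ?U i = xs ! i" if "i < length xs" for i
    using that xs by (intro col_mat_of_cols) auto
  have ca: "xs ! a \<in> carrier_vec n" and cb: "xs ! b \<in> carrier_vec n" using xs a b by auto
  have "(mat_adjoint ?U * M * ?U) $$ (a, b) = (mat_adjoint ?U * (M * ?U)) $$ (a, b)"
    using assoc_mult_mat[OF mat_adjoint_carrier[OF U] M U] by simp
  also have "\<dots> = conjugate (xs ! a) \<bullet> (M *\<^sub>v (xs ! b))"
    using a b cols col_mult2[OF M U b] by simp
  also have "\<dots> = (M *\<^sub>v (xs ! b)) \<bullet>c (xs ! a)"
    using conjugate_vec_sprod_comm[OF mult_mat_vec_carrier[OF M cb] ca] by simp
  finally show ?thesis .
qed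

text \<open>Below the diagonal band an entry is an inner product of \<open>M y\<close>, which has climbed at most one
  block, with a column of a block at least two steps further, hence zero by orthogonality.  Above the band
  the adjoint moves \<open>M\<close> to the other side, which is why \<open>M\<close> and its adjoint are both required to
  climb at most one block.  This condition passes to sums, so \<open>A = H + K\<close> is covered without an argument on
  matrices of blocks.\<close>

lemma block_tridiagonal_compression:
  assumes Us: "orthonormal_blocks n Us" and M: "M \<in> carrier_mat n n"
    and up: "\<And>k x. Suc k < length Us \<Longrightarrow> x \<in> set (cols (Us ! k)) \<Longrightarrow>
      M *\<^sub>v x \<in> cspan n (block_columns Us (Suc k))"
    and up_adjoint: "\<And>k x. Suc k < length Us \<Longrightarrow> x \<in> set (cols (Us ! k)) \<Longrightarrow>
      mat_adjoint M *\<^sub>v x \<in> cspan n (block_columns Us (Suc k))"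
  shows "block_tridiagonal (block_sizes Us)
    (mat_adjoint (concat_blocks n Us) * M * concat_blocks n Us)"
  unfolding block_tridiagonal_def
proof (intro conjI allI impI)
  note U = concat_blocks_isometry(1)[OF Us]
  show "mat_adjoint (concat_blocks n Us) * M * concat_blocks n Us
      \<in> carrier_mat (sum_list (block_sizes Us)) (sum_list (block_sizes Us))"
    by (rule mult_carrier_mat[OF mult_carrier_mat[OF mat_adjoint_carrier[OF U] M] U])
next
  fix i j r c
  assume "i < length (block_sizes Us)" "j < length (block_sizes Us)"
    and far: "Suc i < j \<or> Suc j < i"
    and "r < block_sizes Us ! i" "c < block_sizes Us ! j"
  then have i: "i < length Us" and j: "j < length Us"
    and r: "r < dim_col (Us ! i)" and c: "c < dim_col (Us ! j)"
    by (auto simp: block_sizes_def)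
  define x where "x = col (Us ! i) r"
  define y where "y = col (Us ! j) c"
  have x: "x \<in> set (cols (Us ! i))" and y: "y \<in> set (cols (Us ! j))"
    using r c by (auto simp: x_def y_def cols_def)
  have xc: "x \<in> carrier_vec n" and yc: "y \<in> carrier_vec n"
    using orthonormal_blocksD(3)[OF Us] i j x y by blast+
  have "(M *\<^sub>v y) \<bullet>c x = 0"
    using far
  proof
    assume "Suc j < i"
    then show ?thesis
      using block_columns_orthogonal[OF Us _ i x] up[OF _ y] i by simp
  next
    assume ij: "Suc i < j"
    have "(mat_adjoint M *\<^sub>v x) \<bullet>c y = 0"
      using block_columns_orthogonal[OF Us ij j y] up_adjoint[OF _ x] ij j by simp
    then show ?thesis
      using cscalar_prod_adjoint[OF M yc xc]
        cscalar_prod_conjugate_commute[OF mult_mat_vec_carrier[OF mat_adjoint_carrier[OF M] xc] yc]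
      by simp
  qed
  then show "(mat_adjoint (concat_blocks n Us) * M * concat_blocks n Us) $$
      (sum_list (take i (block_sizes Us)) + r, sum_list (take j (block_sizes Us)) + c) = 0"
    unfolding concat_blocks_def
    using compression_entry[OF M concat_cols_carrier[OF Us], of
        "sum_list (take i (block_sizes Us)) + r" "sum_list (take j (block_sizes Us)) + c"]
      concat_cols_nth[OF i r] concat_cols_nth[OF j c]
    by (simp add: length_concat_cols x_def y_def)
qed

section \<open>Runs of the block Lanczos process\<close>

text \<open>For the first block the matrix without columns stands in for the missing predecessor: its
  projection is zero, so that one formula describes every residual.\<close>

definition previous_block :: "nat \<Rightarrow> complex mat list \<Rightarrow> complex mat" where
  "previous_block n Us = (if length Us = 1 then 0\<^sub>m n 0 else last (butlast Us))"

definition residual_map ::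
  "complex mat \<Rightarrow> complex mat \<Rightarrow> complex mat \<Rightarrow> complex vec \<Rightarrow> complex vec" where
  "residual_map H V P x = H *\<^sub>v x - V *\<^sub>v (mat_adjoint V *\<^sub>v (H *\<^sub>v x))
     - P *\<^sub>v (mat_adjoint P *\<^sub>v (H *\<^sub>v x))"

lemma lanczos_residual_cols:
  assumes H: "H \<in> carrier_mat n n" and V: "last Us \<in> carrier_mat n q"
    and P: "previous_block n Us \<in> carrier_mat n r"
  shows "lanczos_residual H Us \<in> carrier_mat n q"
    and "set (cols (lanczos_residual H Us))
      = residual_map H (last Us) (previous_block n Us) ` set (cols (last Us))"
proof -
  let ?V = "last Us" and ?P = "previous_block n Us"
  note V' = mat_adjoint_carrier[OF V] and P' = mat_adjoint_carrier[OF P]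
  define MV where "MV = ?V * mat_adjoint ?V"
  define MP where "MP = ?P * mat_adjoint ?P"
  have MV: "MV \<in> carrier_mat n n" and MP: "MP \<in> carrier_mat n n"
    unfolding MV_def MP_def using mult_carrier_mat[OF V V'] mult_carrier_mat[OF P P'] by auto
  note car = mult_carrier_mat[OF H V] mult_carrier_mat[OF mult_carrier_mat[OF MV H] V]
    mult_carrier_mat[OF mult_carrier_mat[OF MP H] V]
  have W: "lanczos_residual H Us = H * ?V - MV * H * ?V - MP * H * ?V"
  proof (cases "length Us = 1")
    case True
    have "MP = 0\<^sub>m n n" unfolding MP_def previous_block_def using True by (intro eq_matI) (auto simp: scalar_prod_def)
    then have "MP * H * ?V = 0\<^sub>m n q" using H V by simp
    then show ?thesis
      using True car by (auto simp: lanczos_residual_def Let_def MV_def intro!: eq_matI)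
  next
    case False
    then show ?thesis
      by (simp add: lanczos_residual_def Let_def MV_def MP_def previous_block_def)
  qed
  show Wc: "lanczos_residual H Us \<in> carrier_mat n q"
    unfolding W by (rule minus_carrier_mat[OF car(3)])
  have "col (lanczos_residual H Us) j = residual_map H ?V ?P (col ?V j)" if j: "j < q" for j
  proof -
    let ?x = "col ?V j"
    have x: "?x \<in> carrier_vec n" using V by auto
    have Hx: "H *\<^sub>v ?x \<in> carrier_vec n" by (rule mult_mat_vec_carrier[OF H x])
    have "col (lanczos_residual H Us) j = col (H * ?V) j - col (MV * H * ?V) j - col (MP * H * ?V) j"
    proof -
      have col_minus: "col (X - Y) j = col X j - col Y j"
        if "X \<in> carrier_mat n q" "Y \<in> carrier_mat n q" for X Y :: "complex mat"
        using that j by (intro eq_vecI) auto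
      show ?thesis
        unfolding W col_minus[OF minus_carrier_mat[OF car(2)] car(3)] col_minus[OF car(1,2)] ..
    qed
    also have "\<dots> = H *\<^sub>v ?x - MV *\<^sub>v (H *\<^sub>v ?x) - MP *\<^sub>v (H *\<^sub>v ?x)"
      unfolding col_mult2[OF H V j] col_mult2[OF mult_carrier_mat[OF MV H] V j]
        col_mult2[OF mult_carrier_mat[OF MP H] V j]
        assoc_mult_mat_vec[OF MV H x] assoc_mult_mat_vec[OF MP H x] ..
    also have "\<dots> = residual_map H ?V ?P ?x"
      unfolding residual_map_def MV_def MP_def assoc_mult_mat_vec[OF V V' Hx]
        assoc_mult_mat_vec[OF P P' Hx] ..
    finally show ?thesis .
  qed
  then show "set (cols (lanczos_residual H Us)) = residual_map H ?V ?P ` set (cols ?V)"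
    using Wc V by (auto simp: cols_def image_iff)
qed

text \<open>The invariant of a run: orthonormal blocks whose accumulated spans form a chain of the kind
  required by \<open>commuting_modulo_start_respects_filtration\<close>, with block sizes that do not increase.\<close>

definition lanczos_blocks :: "nat \<Rightarrow> complex mat \<Rightarrow> complex mat list \<Rightarrow> bool" where
  "lanczos_blocks n H Us \<longleftrightarrow> Us \<noteq> [] \<and> orthonormal_blocks n Us \<and>
     (\<forall>k. Suc k < length Us \<longrightarrow>
        (\<forall>x \<in> set (cols (Us ! k)). H *\<^sub>v x \<in> cspan n (block_columns Us (Suc k))) \<and>
        set (cols (Us ! Suc k)) \<subseteq> cspan n (block_columns Us k \<union> (*\<^sub>v) H ` block_columns Us k) \<and>
        dim_col (Us ! Suc k) \<le> dim_col (Us ! k))"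

lemma block_columns_append:
  "k < length Us \<Longrightarrow> block_columns (Us @ [U]) k = block_columns Us k"
  by (auto simp: block_columns_def nth_append)

lemma orthonormal_blocks_append:
  assumes Us: "orthonormal_blocks n Us"
    and U: "U \<in> carrier_mat n (dim_col U)" "mat_adjoint U * U = 1\<^sub>m (dim_col U)"
    and orth: "\<And>j x y. j < length Us \<Longrightarrow> x \<in> set (cols U) \<Longrightarrow> y \<in> set (cols (Us ! j)) \<Longrightarrow>
      x \<bullet>c y = 0"
  shows "orthonormal_blocks n (Us @ [U])"
proof -
  have orth': "y \<bullet>c x = 0"
    if "j < length Us" "x \<in> set (cols U)" "y \<in> set (cols (Us ! j))" for j x y
  proof -
    have "x \<in> carrier_vec n" using cols_dim[of U] U(1) that(2) by auto
    moreover have "y \<in> carrier_vec n" using orthonormal_blocksD(3)[OF Us that(1)] that(3) by blast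
    ultimately have "cnj (x \<bullet>c y) = y \<bullet>c x" by (rule cscalar_prod_conjugate_commute)
    then show ?thesis using orth[OF that] by simp
  qed
  have "(Us @ [U]) ! i \<in> carrier_mat n (dim_col ((Us @ [U]) ! i)) \<and>
      mat_adjoint ((Us @ [U]) ! i) * (Us @ [U]) ! i = 1\<^sub>m (dim_col ((Us @ [U]) ! i))"
    if "i < length (Us @ [U])" for i
  proof (cases "i < length Us")
    case True
    then have nth: "(Us @ [U]) ! i = Us ! i" by (simp add: nth_append)
    show ?thesis unfolding nth using orthonormal_blocksD(1,2)[OF Us True] ..
  next
    case False
    then have nth: "(Us @ [U]) ! i = U" using that by (simp add: nth_append)
    show ?thesis unfolding nth using U ..
  qed
  moreover have "x \<bullet>c y = 0"
    if i: "i < length (Us @ [U])" and j: "j < length (Us @ [U])" and ij: "i \<noteq> j"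
      and x: "x \<in> set (cols ((Us @ [U]) ! i))" and y: "y \<in> set (cols ((Us @ [U]) ! j))" for i j x y
  proof (cases "i < length Us")
    case iU: True
    show ?thesis
    proof (cases "j < length Us")
      case True
      then show ?thesis using orthonormal_blocksD(4)[OF Us iU True ij, of x y] iU x y by (simp add: nth_append)
    next
      case False
      then show ?thesis using orth'[OF iU, of y x] iU x y j by (simp add: nth_append)
    qed
  next
    case False
    then have "j < length Us" using i j ij by simp
    then show ?thesis using orth[of j x y] False x y i by (simp add: nth_append)
  qed
  ultimately show ?thesis unfolding orthonormal_blocks_def by blast
qed

text \<open>The three-term recurrence suffices to make the new block orthogonal to all earlier ones.  Against
  the last two blocks the subtracted projections do it.  Against an older block with column \<open>y\<close>, the
  hermitian symmetry gives \<open>(H x) \<bullet>c y = x \<bullet>c (H y)\<close>, and \<open>H y\<close> lies in the span of blocks that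
  precede the one containing \<open>x\<close>.\<close>

lemma residual_map_orthogonal:
  assumes H: "H \<in> carrier_mat n n" and herm: "hermitian H"
    and Us: "orthonormal_blocks n Us" and ne: "Us \<noteq> []"
    and up: "\<And>k x. Suc k < length Us \<Longrightarrow> x \<in> set (cols (Us ! k)) \<Longrightarrow>
      H *\<^sub>v x \<in> cspan n (block_columns Us (Suc k))"
    and x: "x \<in> set (cols (last Us))"
    and j: "j < length Us" and y: "y \<in> set (cols (Us ! j))"
  shows "residual_map H (last Us) (previous_block n Us) x \<bullet>c y = 0"
proof -
  define m where "m = length Us - 1"
  have m: "m < length Us" using ne by (simp add: m_def)
  have V: "last Us = Us ! m" using ne by (simp add: last_conv_nth m_def)
  let ?V = "last Us" and ?P = "previous_block n Us"
  have P: "?P = 0\<^sub>m n 0 \<and> m = 0 \<or> (\<exists>p. m = Suc p \<and> ?P = Us ! p)"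
  proof (cases "length Us = 1")
    case True
    then have "?P = 0\<^sub>m n 0" "m = 0" unfolding previous_block_def m_def by simp_all
    then show ?thesis by blast
  next
    case False
    define p where "p = length Us - 2"
    have p: "length Us = Suc (Suc p)" using False m unfolding p_def by linarith
    then have "?P = Us ! p"
      using False by (simp add: previous_block_def last_conv_nth nth_butlast flip: length_greater_0_conv)
    moreover have "m = Suc p" using p by (simp add: m_def)
    ultimately show ?thesis by blast
  qed
  have Vc: "?V \<in> carrier_mat n (dim_col ?V)" and VI: "mat_adjoint ?V * ?V = 1\<^sub>m (dim_col ?V)"
    unfolding V by (rule orthonormal_blocksD(1,2)[OF Us m])+
  have Pc: "?P \<in> carrier_mat n (dim_col ?P)"
    using P
  proof
    assume "?P = 0\<^sub>m n 0 \<and> m = 0"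
    then show ?thesis by simp
  next
    assume "\<exists>p. m = Suc p \<and> ?P = Us ! p"
    then obtain p where p: "m = Suc p" "?P = Us ! p" by blast
    then have "p < length Us" using m by simp
    then show ?thesis unfolding p(2) by (rule orthonormal_blocksD(1)[OF Us])
  qed
  have yc: "y \<in> carrier_vec n" using orthonormal_blocksD(3)[OF Us j] y by blast
  have xc: "x \<in> carrier_vec n" using orthonormal_blocksD(3)[OF Us m] x unfolding V by blast
  have Hx: "H *\<^sub>v x \<in> carrier_vec n" by (rule mult_mat_vec_carrier[OF H xc])
  let ?a = "H *\<^sub>v x" and ?b = "?V *\<^sub>v (mat_adjoint ?V *\<^sub>v (H *\<^sub>v x))"
    and ?c = "?P *\<^sub>v (mat_adjoint ?P *\<^sub>v (H *\<^sub>v x))"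
  have tV: "mat_adjoint ?V *\<^sub>v (H *\<^sub>v x) \<in> carrier_vec (dim_col ?V)"
    by (rule mult_mat_vec_carrier[OF mat_adjoint_carrier[OF Vc] Hx])
  have tP: "mat_adjoint ?P *\<^sub>v (H *\<^sub>v x) \<in> carrier_vec (dim_col ?P)"
    by (rule mult_mat_vec_carrier[OF mat_adjoint_carrier[OF Pc] Hx])
  have bc: "?b \<in> carrier_vec n" and cc: "?c \<in> carrier_vec n"
    using mult_mat_vec_carrier[OF Vc tV] mult_mat_vec_carrier[OF Pc tP] by auto
  have split: "residual_map H ?V ?P x \<bullet>c y = ?a \<bullet>c y - ?b \<bullet>c y - ?c \<bullet>c y"
    unfolding residual_map_def using Hx bc cc yc by (simp add: minus_scalar_prod_distrib[of _ n])
  have proj_V: "?b \<bullet>c y = (if j = m then ?a \<bullet>c y else 0)"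
  proof (cases "j = m")
    case True
    then show ?thesis using projection_cscalar_prod[OF Vc VI Hx] y unfolding V by simp
  next
    case False
    have "?b \<bullet>c y = 0"
    proof (rule cspan_orthogonal[OF _ yc _ mult_mat_vec_in_cspan_cols[OF Vc tV]])
      show "set (cols ?V) \<subseteq> carrier_vec n" using orthonormal_blocksD(3)[OF Us m] V by simp
      show "z \<bullet>c y = 0" if "z \<in> set (cols ?V)" for z
        using orthonormal_blocksD(4)[OF Us m j _ _ y] that V False by auto
    qed
    then show ?thesis using False by simp
  qed
  have proj_P: "?c \<bullet>c y = (if Suc j = m then ?a \<bullet>c y else 0)"
  proof (cases "Suc j = m")
    case True
    then have "?P = Us ! j" using P by auto
    then show ?thesis
      using projection_cscalar_prod[OF orthonormal_blocksD(1,2)[OF Us j] Hx y] True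
      by (simp only: simp_thms if_True)
  next
    case False
    have "?c \<bullet>c y = 0"
    proof (rule cspan_orthogonal[OF _ yc _ mult_mat_vec_in_cspan_cols[OF Pc tP]])
      show "set (cols ?P) \<subseteq> carrier_vec n" using cols_dim[of ?P] Pc by auto
      show "z \<bullet>c y = 0" if z: "z \<in> set (cols ?P)" for z
      proof -
        from P obtain p where p: "m = Suc p" "?P = Us ! p"
          using z by (auto simp: cols_def)
        then show ?thesis
          using orthonormal_blocksD(4)[OF Us _ j _ _ y, of p z] z m False by auto
      qed
    qed
    then show ?thesis using False by simp
  qed
  \<comment> \<open>The blocks before the last two, for which nothing is subtracted explicitly.\<close>
  have far: "?a \<bullet>c y = 0" if "Suc j < m"
  proof -
    have "H *\<^sub>v y \<in> cspan n (block_columns Us (Suc j))" using up[OF _ y] that m by simp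
    then have "(H *\<^sub>v y) \<bullet>c x = 0"
      using block_columns_orthogonal[OF Us that m] x V by simp
    moreover have "mat_adjoint H = H" using herm by (simp add: hermitian_def)
    ultimately show ?thesis
      using cscalar_prod_adjoint[OF H xc yc]
        cscalar_prod_conjugate_commute[OF mult_mat_vec_carrier[OF H yc] xc] by simp
  qed
  have "j \<le> m" using j by (simp add: m_def)
  then consider "j = m" | "Suc j = m" | "Suc j < m" by linarith
  then show ?thesis
    by cases (auto simp: split proj_V proj_P far)
qed

text \<open>The residual of a column \<open>x\<close> of the last block is \<open>H x\<close> up to vectors in the span of the
  last two blocks.  Read one way, this places \<open>H x\<close> in the span of the extended list of blocks; read the other way,
  it places the new block in the span of the old blocks and their images under \<open>H\<close>.\<close>

lemma lanczos_blocks_step: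
  assumes H: "H \<in> carrier_mat n n" and herm: "hermitian H"
    and Us: "lanczos_blocks n H Us"
    and U: "columns_orthonormal_basis n U (column_space n (lanczos_residual H Us))"
  shows "lanczos_blocks n H (Us @ [U])"
proof -
  have ne: "Us \<noteq> []" and ob: "orthonormal_blocks n Us"
    and up: "\<And>k x. Suc k < length Us \<Longrightarrow> x \<in> set (cols (Us ! k)) \<Longrightarrow>
      H *\<^sub>v x \<in> cspan n (block_columns Us (Suc k))"
    using Us by (auto simp: lanczos_blocks_def)
  define m where "m = length Us - 1"
  have len: "length Us = Suc m" using ne by (simp add: m_def)
  then have m: "m < length Us" by simp
  let ?V = "last Us" and ?P = "previous_block n Us" and ?W = "lanczos_residual H Us"
  let ?B = "block_columns Us m"
  have V: "?V = Us ! m" using ne by (simp add: last_conv_nth m_def)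
  have Bc: "?B \<subseteq> carrier_vec n" by (rule block_columns_carrier[OF ob m])
  have VB: "set (cols ?V) \<subseteq> ?B" unfolding V by (auto simp: block_columns_def)
  have PB: "set (cols ?P) \<subseteq> ?B \<and> ?P \<in> carrier_mat n (dim_col ?P)"
  proof (cases "length Us = 1")
    case True
    then show ?thesis by (simp add: previous_block_def cols_def)
  next
    case False
    then have m0: "0 < m" using len by simp
    then have "?P = Us ! (m - 1)"
      using False len
      by (simp add: previous_block_def last_conv_nth nth_butlast flip: length_greater_0_conv)
    moreover have "m - 1 < length Us" using len by simp
    moreover have "set (cols (Us ! (m - 1))) \<subseteq> ?B"
      unfolding block_columns_def by (rule UN_upper) simp
    ultimately show ?thesis
      using orthonormal_blocksD(1)[OF ob, of "m - 1"] by metis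
  qed
  have Vc: "?V \<in> carrier_mat n (dim_col ?V)" unfolding V by (rule orthonormal_blocksD(1)[OF ob m])
  have Pc: "?P \<in> carrier_mat n (dim_col ?P)" using PB by simp
  note W = lanczos_residual_cols[OF H Vc Pc]
  have Ucar: "U \<in> carrier_mat n (dim_col U)" and UI: "mat_adjoint U * U = 1\<^sub>m (dim_col U)"
    and Uspan: "cspan n (set (cols U)) = cspan n (set (cols ?W))"
    using U unfolding columns_orthonormal_basis_def column_space_eq_cspan_cols by auto
  have Uc: "set (cols U) \<subseteq> carrier_vec n" using cols_dim[of U] Ucar by auto
  have Wc: "set (cols ?W) \<subseteq> carrier_vec n" using cols_dim[of ?W] W(1) by auto
  have UW: "set (cols U) \<subseteq> cspan n (set (cols ?W))" using cspan_superset[OF Uc] Uspan by simp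
  have ob': "orthonormal_blocks n (Us @ [U])"
  proof (rule orthonormal_blocks_append[OF ob Ucar UI])
    fix j x y assume j: "j < length Us" and x: "x \<in> set (cols U)" and y: "y \<in> set (cols (Us ! j))"
    have yc: "y \<in> carrier_vec n" using orthonormal_blocksD(3)[OF ob j] y by blast
    show "x \<bullet>c y = 0"
    proof (rule cspan_orthogonal[OF Wc yc])
      show "x \<in> cspan n (set (cols ?W))" using UW x by blast
      show "w \<bullet>c y = 0" if "w \<in> set (cols ?W)" for w
        using that unfolding W(2) using residual_map_orthogonal[OF H herm ob ne up _ j y] by auto
    qed
  qed
  have Hx: "H *\<^sub>v x \<in> carrier_vec n" if "x \<in> ?B" for x
    using mult_mat_vec_carrier[OF H] Bc that by blast
  have projs: "?V *\<^sub>v (mat_adjoint ?V *\<^sub>v (H *\<^sub>v x)) \<in> cspan n ?B"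
    "?P *\<^sub>v (mat_adjoint ?P *\<^sub>v (H *\<^sub>v x)) \<in> cspan n ?B" if x: "x \<in> ?B" for x
  proof -
    have "mat_adjoint ?V *\<^sub>v (H *\<^sub>v x) \<in> carrier_vec (dim_col ?V)"
      by (rule mult_mat_vec_carrier[OF mat_adjoint_carrier[OF Vc] Hx[OF x]])
    then show "?V *\<^sub>v (mat_adjoint ?V *\<^sub>v (H *\<^sub>v x)) \<in> cspan n ?B"
      using mult_mat_vec_in_cspan_cols[OF Vc] cspan_mono[OF VB] by blast
    have "mat_adjoint ?P *\<^sub>v (H *\<^sub>v x) \<in> carrier_vec (dim_col ?P)"
      by (rule mult_mat_vec_carrier[OF mat_adjoint_carrier[OF Pc] Hx[OF x]])
    then show "?P *\<^sub>v (mat_adjoint ?P *\<^sub>v (H *\<^sub>v x)) \<in> cspan n ?B"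
      using mult_mat_vec_in_cspan_cols[OF Pc] cspan_mono[of "set (cols ?P)" ?B] PB by blast
  qed
  have next_columns: "block_columns (Us @ [U]) (Suc m) = ?B \<union> set (cols U)"
    using len by (simp add: block_columns_Suc block_columns_append nth_append)
  have NBc: "?B \<union> set (cols U) \<subseteq> carrier_vec n" using Bc Uc by simp
  have up_m: "H *\<^sub>v x \<in> cspan n (?B \<union> set (cols U))" if x: "x \<in> set (cols ?V)" for x
  proof -
    have xB: "x \<in> ?B" using x VB by blast
    let ?b = "?V *\<^sub>v (mat_adjoint ?V *\<^sub>v (H *\<^sub>v x))" and ?c = "?P *\<^sub>v (mat_adjoint ?P *\<^sub>v (H *\<^sub>v x))"
    let ?w = "residual_map H ?V ?P x"
    have bB: "?b \<in> cspan n ?B" and cB: "?c \<in> cspan n ?B" using projs[OF xB] by auto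
    have mono: "cspan n ?B \<subseteq> cspan n (?B \<union> set (cols U))"
      "cspan n (set (cols U)) \<subseteq> cspan n (?B \<union> set (cols U))" by (rule cspan_mono, simp)+
    have "?w \<in> set (cols ?W)" unfolding W(2) using x by blast
    then have w: "?w \<in> cspan n (set (cols U))" using cspan_superset[OF Wc] Uspan by blast
    have bcar: "?b \<in> carrier_vec n" and ccar: "?c \<in> carrier_vec n"
      using bB cB cspan_carrier[OF Bc] by auto
    have "H *\<^sub>v x = (?w + ?b) + ?c"
    proof -
      have "a = ((a - b - c) + b) + c"
        if "a \<in> carrier_vec n" "b \<in> carrier_vec n" "c \<in> carrier_vec n" for a b c :: "complex vec"
        using that by (intro eq_vecI) auto
      then show ?thesis
        unfolding residual_map_def using Hx[OF xB] bcar ccar by blast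
    qed
    moreover have "(?w + ?b) + ?c \<in> cspan n (?B \<union> set (cols U))"
      using w bB cB mono by (intro cspan_add[OF NBc]) blast+
    ultimately show ?thesis by metis
  qed
  have gen_m: "set (cols U) \<subseteq> cspan n (?B \<union> (*\<^sub>v) H ` ?B)"
  proof -
    have HBc: "?B \<union> (*\<^sub>v) H ` ?B \<subseteq> carrier_vec n" using Bc Hx by blast
    have mono: "cspan n ?B \<subseteq> cspan n (?B \<union> (*\<^sub>v) H ` ?B)" by (rule cspan_mono) simp
    have "residual_map H ?V ?P x \<in> cspan n (?B \<union> (*\<^sub>v) H ` ?B)" if x: "x \<in> set (cols ?V)" for x
    proof -
      have xB: "x \<in> ?B" using x VB by blast
      then have "H *\<^sub>v x \<in> cspan n (?B \<union> (*\<^sub>v) H ` ?B)" using cspan_superset[OF HBc] by blast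
      moreover note projs[OF xB]
      ultimately show ?thesis
        unfolding residual_map_def using mono by (intro cspan_diff[OF HBc]) auto
    qed
    then have "set (cols ?W) \<subseteq> cspan n (?B \<union> (*\<^sub>v) H ` ?B)" unfolding W(2) by blast
    then show ?thesis using UW cspan_minimal[OF HBc] by blast
  qed
  have dim_m: "dim_col U \<le> dim_col ?V"
    using orthonormal_cols_dim_le[OF Ucar UI W(1)] U by (simp add: columns_orthonormal_basis_def)
  show ?thesis
    unfolding lanczos_blocks_def
  proof (intro conjI allI impI)
    show "Us @ [U] \<noteq> []" by simp
    show "orthonormal_blocks n (Us @ [U])" by (rule ob')
    fix k assume "Suc k < length (Us @ [U])"
    then have "k < length Us" by simp
    then consider (old) "Suc k < length Us" | (new) "k = m" using len by linarith
    then have "(\<forall>x \<in> set (cols ((Us @ [U]) ! k)). H *\<^sub>v x \<in> cspan n (block_columns (Us @ [U]) (Suc k))) \<and>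
      set (cols ((Us @ [U]) ! Suc k)) \<subseteq> cspan n (block_columns (Us @ [U]) k \<union>
        (*\<^sub>v) H ` block_columns (Us @ [U]) k) \<and>
      dim_col ((Us @ [U]) ! Suc k) \<le> dim_col ((Us @ [U]) ! k)"
    proof cases
      case old
      then show ?thesis
        using Us by (simp add: lanczos_blocks_def block_columns_append nth_append)
    next
      case new
      have nth: "(Us @ [U]) ! k = ?V" "(Us @ [U]) ! Suc k = U"
        using new len V by (simp_all add: nth_append)
      show ?thesis
        unfolding nth unfolding new next_columns block_columns_append[OF m]
        using up_m gen_m dim_m by blast
    qed
    then show "\<forall>x \<in> set (cols ((Us @ [U]) ! k)). H *\<^sub>v x \<in> cspan n (block_columns (Us @ [U]) (Suc k))"
      and "set (cols ((Us @ [U]) ! Suc k)) \<subseteq> cspan n (block_columns (Us @ [U]) k \<union>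
        (*\<^sub>v) H ` block_columns (Us @ [U]) k)"
      and "dim_col ((Us @ [U]) ! Suc k) \<le> dim_col ((Us @ [U]) ! k)" by auto
  qed
qed

lemma lanczos_run_blocks:
  assumes H: "H \<in> carrier_mat n n" and herm: "hermitian H"
    and run: "lanczos_run n H Z Us"
  shows "lanczos_blocks n H Us \<and> columns_orthonormal_basis n (Us ! 0) (column_space n Z)"
  using run
proof induction
  case (start U)
  then show ?case
    by (simp add: lanczos_blocks_def orthonormal_blocks_def columns_orthonormal_basis_def)
next
  case (step Us W U)
  then have "lanczos_blocks n H (Us @ [U])"
    using lanczos_blocks_step[OF H herm] by simp
  moreover have "(Us @ [U]) ! 0 = Us ! 0"
    using step by (simp add: lanczos_blocks_def nth_append)
  ultimately show ?case using step by simp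
qed

lemma lanczos_block_dim_le:
  assumes "lanczos_blocks n H Us" and "i < length Us"
  shows "dim_col (Us ! i) \<le> dim_col (Us ! 0)"
  using assms(2)
proof (induction i)
  case (Suc i)
  then have "dim_col (Us ! Suc i) \<le> dim_col (Us ! i)"
    using assms(1) by (simp add: lanczos_blocks_def)
  then show ?case using Suc by simp
qed simp

text \<open>The accumulated spans of the blocks are the chain to which
  \<open>commuting_modulo_start_respects_filtration\<close> applies; its level 0 is the first block.\<close>

lemma lanczos_blocks_filtration_respected:
  assumes H: "H \<in> carrier_mat n n" and K: "K \<in> carrier_mat n n" and S: "S \<subseteq> carrier_vec n"
    and Us: "lanczos_blocks n H Us" and U0: "column_space n (Us ! 0) = cspan n S"
    and base: "\<And>x. x \<in> S \<Longrightarrow> K *\<^sub>v x \<in> cspan n (S \<union> (*\<^sub>v) H ` S)"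
    and comm: "\<And>x. x \<in> carrier_vec n \<Longrightarrow> H *\<^sub>v (K *\<^sub>v x) - K *\<^sub>v (H *\<^sub>v x) \<in> cspan n S"
    and k: "Suc k < length Us" and x: "x \<in> set (cols (Us ! k))"
  shows "K *\<^sub>v x \<in> cspan n (block_columns Us (Suc k))"
proof -
  define m where "m = length Us - 1"
  \<comment> \<open>Truncation at the last block keeps \<open>G\<close> within the list for every index; below \<open>m\<close> it does not act.\<close>
  define G where "G i = block_columns Us (min i m)" for i
  have ob: "orthonormal_blocks n Us" and ne: "Us \<noteq> []"
    using Us by (auto simp: lanczos_blocks_def)
  have len: "length Us = Suc m" using ne by (simp add: m_def)
  have Gc: "G i \<subseteq> carrier_vec n" for i
    unfolding G_def by (rule block_columns_carrier[OF ob]) (simp add: len)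
  have G_eq: "G i = block_columns Us i" if "i \<le> m" for i using that by (simp add: G_def)
  have G0: "cspan n (G 0) = cspan n S"
    using U0 unfolding column_space_eq_cspan_cols by (simp add: G_def block_columns_def)
  have mono: "G i \<subseteq> cspan n (G (Suc i))" if "i < m" for i
    using that cspan_superset[OF Gc[of "Suc i"]] by (auto simp: G_eq block_columns_Suc)
  have up: "H *\<^sub>v y \<in> cspan n (G (Suc i))" if i: "i < m" and y: "y \<in> G i" for i y
  proof -
    obtain j where j: "j \<le> i" "y \<in> set (cols (Us ! j))"
      using y i by (auto simp: G_eq block_columns_def)
    then have "H *\<^sub>v y \<in> cspan n (block_columns Us (Suc j))"
      using Us i len by (simp add: lanczos_blocks_def)
    moreover have "block_columns Us (Suc j) \<subseteq> block_columns Us (Suc i)"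
      using j(1) unfolding block_columns_def by (intro UN_mono) auto
    ultimately have "H *\<^sub>v y \<in> cspan n (block_columns Us (Suc i))"
      using cspan_mono by blast
    then show ?thesis using i by (simp add: G_eq)
  qed
  have gen: "G (Suc i) \<subseteq> cspan n (G i \<union> (*\<^sub>v) H ` G i)" if i: "Suc i < m" for i
  proof -
    have "(*\<^sub>v) H ` G i \<subseteq> carrier_vec n" using mult_mat_vec_carrier[OF H] Gc by blast
    then have "G i \<subseteq> cspan n (G i \<union> (*\<^sub>v) H ` G i)"
      using cspan_superset[of "G i \<union> (*\<^sub>v) H ` G i" n] Gc by blast
    moreover have "set (cols (Us ! Suc i)) \<subseteq> cspan n (G i \<union> (*\<^sub>v) H ` G i)"
      using Us i len by (simp add: lanczos_blocks_def G_eq)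
    ultimately show ?thesis using i by (simp add: G_eq block_columns_Suc)
  qed
  have "x \<in> G k" using x k len by (auto simp: G_eq block_columns_def)
  then have "x \<in> cspan n (G k)" using cspan_superset[OF Gc] by blast
  then have "K *\<^sub>v x \<in> cspan n (G (Suc k))"
    using commuting_modulo_start_respects_filtration
      [where G = G and m = m, OF H K S Gc G0 mono up gen base comm, of k x] k len by simp
  then show ?thesis using k len by (simp add: G_eq)
qed

section \<open>Block tridiagonal reduction of an almost normal matrix\<close>

theorem theorem4:
  fixes n :: nat and A C :: "complex mat" and u v :: "complex vec"
  assumes A: "A \<in> carrier_mat n n"
    and u: "u \<in> carrier_vec n" "u \<noteq> 0\<^sub>v n"
    and v: "v \<in> carrier_vec n" "v \<noteq> 0\<^sub>v n"
    and C: "C = outer_product n u v"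
    and almost_normal: "almost_normal_via n 1 A C"
    and indpt: "lin_indpt_pair n u v"
  shows "(\<forall>j l m X Y.
            X \<in> carrier_mat n l \<and> column_space n X = cspan n {u, v} \<and>
            Y \<in> carrier_mat n m \<and> column_space n Y = cspan n {u, v} \<longrightarrow>
            krylov n j (antihermitian_part A) X \<subseteq> krylov n j (hermitian_part A) Y) \<and>
         (\<forall>l Z Us U.
            Z \<in> carrier_mat n l \<and> l \<le> n \<and> column_space n Z = cspan n {u, v} \<and>
            block_lanczos_output n (hermitian_part A) Z Us \<and> U = concat_blocks n Us \<longrightarrow>
            unitary n U \<and>
            block_tridiagonal (block_sizes Us) (mat_adjoint U * hermitian_part A * U) \<and>
            block_tridiagonal (block_sizes Us) (mat_adjoint U * antihermitian_part A * U) \<and>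
            block_tridiagonal (block_sizes Us) (mat_adjoint U * A * U) \<and>
            (\<forall>i \<in> set (block_sizes Us). i \<le> 2))"
proof -
  define H where "H = hermitian_part A"
  define K where "K = antihermitian_part A"
  have H: "H \<in> carrier_mat n n" and K: "K \<in> carrier_mat n n"
    unfolding H_def K_def
    using hermitian_part_carrier[OF A] antihermitian_part_carrier[OF A] by auto
  have S: "{u, v} \<subseteq> carrier_vec n" using u v by simp
  have D: "mat_adjoint A * A - A * mat_adjoint A
      = outer_product n u v * A - A * outer_product n u v"
    using almost_normal C by (simp add: almost_normal_via_def)
  have base: "K *\<^sub>v x \<in> cspan n ({u, v} \<union> (*\<^sub>v) H ` {u, v})" if "x \<in> {u, v}" for x
    unfolding H_def K_def
    by (rule almost_normal_antihermitian_image[OF A u v indpt D that])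
  have comm: "H *\<^sub>v (K *\<^sub>v x) - K *\<^sub>v (H *\<^sub>v x) \<in> cspan n {u, v}" if "x \<in> carrier_vec n" for x
    unfolding H_def K_def
    by (rule almost_normal_commutator[OF A u v indpt D that])
  show ?thesis
    unfolding H_def[symmetric] K_def[symmetric]
  proof (intro conjI allI impI ballI; elim conjE)
    fix j l m X Y
    assume "X \<in> carrier_mat n l" "column_space n X = cspan n {u, v}"
      and "Y \<in> carrier_mat n m" "column_space n Y = cspan n {u, v}"
    then show "krylov n j K X \<subseteq> krylov n j H Y"
      using base comm by (rule krylov_subset_krylov[OF H K S])
  next
    fix l Z Us U
    assume Z: "column_space n Z = cspan n {u, v}"
      and out: "block_lanczos_output n H Z Us" and U: "U = concat_blocks n Us"
    have herm: "hermitian H" and run: "lanczos_run n H Z Us"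
      and stop: "n \<le> sum_list (block_sizes Us)"
      using out by (auto simp: block_lanczos_output_def)
    have Us: "lanczos_blocks n H Us"
      and U0: "columns_orthonormal_basis n (Us ! 0) (cspan n {u, v})"
      using lanczos_run_blocks[OF H herm run] Z by auto
    then have ob: "orthonormal_blocks n Us" by (simp add: lanczos_blocks_def)
    have U0_span: "column_space n (Us ! 0) = cspan n {u, v}"
      using U0 by (simp add: columns_orthonormal_basis_def)
    show "unitary n U" unfolding U by (rule concat_blocks_unitary[OF ob stop])
    have upH: "H *\<^sub>v x \<in> cspan n (block_columns Us (Suc k))"
      if "Suc k < length Us" "x \<in> set (cols (Us ! k))" for k x
      using Us that by (simp add: lanczos_blocks_def)
    have upK: "K *\<^sub>v x \<in> cspan n (block_columns Us (Suc k))"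
      if "Suc k < length Us" "x \<in> set (cols (Us ! k))" for k x
      by (rule lanczos_blocks_filtration_respected[OF H K S Us U0_span base comm that])
    have xc: "x \<in> carrier_vec n" if "Suc k < length Us" "x \<in> set (cols (Us ! k))" for k x
      using orthonormal_blocksD(3)[OF ob, of k] that by auto
    have Bc: "block_columns Us (Suc k) \<subseteq> carrier_vec n" if "Suc k < length Us" for k
      by (rule block_columns_carrier[OF ob that])
    have adjH: "mat_adjoint H = H" using herm by (simp add: hermitian_def)
    show "block_tridiagonal (block_sizes Us) (mat_adjoint U * H * U)"
      unfolding U using upH by (intro block_tridiagonal_compression[OF ob H]) (simp_all add: adjH)
    show "block_tridiagonal (block_sizes Us) (mat_adjoint U * K * U)"
      unfolding U
    proof (rule block_tridiagonal_compression[OF ob K upK])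
      fix k x assume kx: "Suc k < length Us" "x \<in> set (cols (Us ! k))"
      have "0\<^sub>v n - K *\<^sub>v x \<in> cspan n (block_columns Us (Suc k))"
        by (rule cspan_diff[OF Bc[OF kx(1)] cspan_zero upK[OF kx]])
      moreover have "mat_adjoint K *\<^sub>v x = 0\<^sub>v n - K *\<^sub>v x"
        unfolding K_def mat_adjoint_antihermitian_part[OF A]
        unfolding K_def[symmetric] using K xc[OF kx] by (intro eq_vecI) auto
      ultimately show "mat_adjoint K *\<^sub>v x \<in> cspan n (block_columns Us (Suc k))" by simp
    qed
    show "block_tridiagonal (block_sizes Us) (mat_adjoint U * A * U)"
      unfolding U
    proof (rule block_tridiagonal_compression[OF ob A])
      fix k x assume kx: "Suc k < length Us" "x \<in> set (cols (Us ! k))"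
      have "A *\<^sub>v x = H *\<^sub>v x + K *\<^sub>v x"
        using add_mult_distrib_mat_vec[OF H K xc[OF kx]]
          hermitian_part_plus_antihermitian_part[OF A] by (simp add: H_def K_def)
      then show "A *\<^sub>v x \<in> cspan n (block_columns Us (Suc k))"
        using cspan_add[OF Bc[OF kx(1)] upH[OF kx] upK[OF kx]] by simp
      have "mat_adjoint A *\<^sub>v x = H *\<^sub>v x - K *\<^sub>v x"
        using minus_mult_distrib_mat_vec[OF H K xc[OF kx]]
          mat_adjoint_eq_hermitian_part_minus_antihermitian_part[OF A] by (simp add: H_def K_def)
      then show "mat_adjoint A *\<^sub>v x \<in> cspan n (block_columns Us (Suc k))"
        using cspan_diff[OF Bc[OF kx(1)] upH[OF kx] upK[OF kx]] by simp
    qed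
    fix i assume "i \<in> set (block_sizes Us)"
    then obtain k where k: "k < length Us" "i = dim_col (Us ! k)"
      by (auto simp: block_sizes_def in_set_conv_nth)
    have "dim_col (Us ! 0) \<le> 2"
      using orthonormal_cols_dim_le_2[of "Us ! 0" n _ u v] U0 u(1) v(1)
      by (auto simp: columns_orthonormal_basis_def)
    then show "i \<le> 2" using lanczos_block_dim_le[OF Us k(1)] k(2) by simp
  qed
qed

end
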